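(* Let $\mathfrak g$ be a simply laced Kac–Moody algebra. The algebra morphisms $\rho: DY^{\mathsf c}(\mathfrak g)\to\widetilde{\mathrm{End}}_{\mathbb C}\mathcal V$ and $\varrho=\rho\circ\iota:Y(\mathfrak g)\to\widetilde{\mathrm{End}}_{\mathbb C}\mathcal V$ are $\mathbb Z$-filtered morphisms, and the composition of $\mathrm{gr}\,\rho:\mathrm{gr}_{\mathbb Z}DY^{\mathsf c}(\mathfrak g)\to\mathrm{End}_{\mathbb C}\mathcal V$ with the morphism $\phi_D:U(\mathfrak t)\to\mathrm{gr}_{\mathbb Z}DY^{\mathsf c}(\mathfrak g)$ is the representation $$\rho_0:U(\mathfrak t)\to\mathrm{End}_{\mathbb C}\mathcal V,\qquad X_i^\pm(z)\mapsto\mathring{\mathbf X}_i^\pm(z)\quad\text{for all } i\in I,$$ where $$\mathring{\mathbf X}_i^\pm(z)=\pm\exp\Big(\pm\sum_{r>0}\frac{\widetilde{\mathcal H}_{i,-r}}rz^r\Big)\exp\Big(\mp\sum_{r>0}\frac{\mathcal H_{ir}}rz^{-r}\Big)e^{\pm\alpha_i}z^{\partial_{\pm\alpha_i}},\qquad \widetilde{\mathcal H}_{i,-r}=\sum_{j\in I}(\alpha_i,\alpha_j)\mathcal H_{j,-r}.$$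
   Context: Setting. $\mathfrak g$ has indecomposable symmetric Cartan matrix $\mathbf A=(a_{ij})_{i,j\in I}$ with $a_{ii}=2$ and $a_{ij}\in\{0,-1\}$ for $i\ne j$. Simple roots $\alpha_i$, root lattice $Q=\bigoplus\mathbb Z\alpha_i$, invariant form normalized by $(\alpha_i,\alpha_i)=2$, $d_{ij}=\frac12(\alpha_i,\alpha_j)$. $DY^{\mathsf c}(\mathfrak g)$. $\delta(w,z)=\sum_{r\in\mathbb Z}w^rz^{-r-1}$; powers $(w+a)^r$, $r<0$, are expanded in nonnegative powers of $aw^{-1}$. $DY^{\mathsf c}(\mathfrak g)$ is the unital associative $\mathbb C$-algebra generated by $\mathsf c$ and $x_{ir}^\pm,h_{ir}$ ($i\in I$, $r\in\mathbb Z$). Put $x_i^\pm(z)=\sum_{r\in\mathbb Z}x_{ir}^\pm z^{-r-1}$, $\tilde h_i^+(z)=\sum_{r\ge0}h_{ir}z^{-r-1}$, $\tilde h_i^-(z)=\sum_{r<0}h_{ir}z^{-r-1}$, $\mathsf c_{ij}^\pm=d_{ij}\pm\frac{\mathsf c}{2}$. Relations: $\mathsf c$ is central; $[\tilde h_i^\pm(z),\tilde h_j^\pm(w)]=0$ (same signs); $$((z-w)^2-(\mathsf c_{ij}^+)^2)\tilde h_j^-(w)\tilde h_i^+(z)-((z-w)^2-(\mathsf c_{ij}^-)^2)\tilde h_i^+(z)\tilde h_j^-(w)=-2d_{ij}\mathsf c+2d_{ij}(\tilde h_j^-(w)-\tilde h_i^+(z))\mathsf c;$$ $$(z-w\mp\mathsf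 c_{ij}^-)\tilde h_i^+(z)x_j^\pm(w)-(z-w\pm\mathsf c_{ij}^+)x_j^\pm(w)\tilde h_i^+(z)=\pm2d_{ij}x_j^\pm(w);$$ $$(z-w\pm d_{ij})x_j^\pm(w)\tilde h_i^-(z)-(z-w\mp d_{ij})\tilde h_i^-(z)x_j^\pm(w)=\pm2d_{ij}x_j^\pm(w);$$ $$(z-w\mp d_{ij})x_i^\pm(z)x_j^\pm(w)=(z-w\pm d_{ij})x_j^\pm(w)x_i^\pm(z);$$ $$[x_i^+(z),x_j^-(w)]=\delta_{ij}\Big(\delta(w+\mathsf c,z)-\delta(w,z)+\delta(w+\mathsf c,z)\tilde h_i^+(w+\tfrac{\mathsf c}2)+\delta(w,z)\tilde h_i^-(z)\Big);$$ $$\sum_{\sigma\in S_m}[x_i^\pm(z_{\sigma(1)}),[\cdots,[x_i^\pm(z_{\sigma(m)}),x_j^\pm(w)]\cdots]]=0\quad(i\ne j,\ m=1-a_{ij}).$$ It is $\mathbb Z$-filtered: $\mathbf F_k^D$ is the span of monomials in the generators of degree $\le k$, with $\deg\mathsf c=0$, $\deg x_{ir}^\pm=\deg h_{ir}=r$; $\mathrm{gr}_{\mathbb Z}DY^{\mathsf c}(\mathfrak g)=\bigoplus_k\mathbf F^D_k/\mathbf F^D_{k-1}$. $Y(\mathfrak g)$ is the unital associative $\mathbb C$-algebra generated by $x_{ir}^\pm,h_{ir}$ ($i\in I$, $r\ge0$) with relations $[h_{ir},h_{js}]=0$; $[h_{i0},x_{js}^\pm]=\pm2d_{ij}x_{js}^\pm$;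 $[x_{ir}^+,x_{js}^-]=\delta_{ij}h_{i,r+s}$; $[h_{i,r+1},x_{js}^\pm]-[h_{ir},x_{j,s+1}^\pm]=\pm d_{ij}(h_{ir}x_{js}^\pm+x_{js}^\pm h_{ir})$; $[x_{i,r+1}^\pm,x_{js}^\pm]-[x_{ir}^\pm,x_{j,s+1}^\pm]=\pm d_{ij}(x_{ir}^\pm x_{js}^\pm+x_{js}^\pm x_{ir}^\pm)$; $\sum_{\sigma\in S_m}[x_{ir_{\sigma(1)}}^\pm,[\cdots,[x_{ir_{\sigma(m)}}^\pm,x_{js}^\pm]\cdots]]=0$ for $i\ne j$, $m=1-a_{ij}$. It is filtered by $\mathbf F_k$ = span of monomials of degree $\le k$, $\deg x_{ir}^\pm=\deg h_{ir}=r$, with $\mathbf F_k=0$ for $k<0$. The algebra morphism $\iota:Y(\mathfrak g)\to DY^{\mathsf c}(\mathfrak g)$ is given by $\sum_{r\ge0}x_{ir}^\pm z^{-r-1}\mapsto\boldsymbol x_i^\pm(z\pm\frac{\mathsf c}2)$, $\sum_{r\ge0}h_{ir}z^{-r-1}\mapsto\tilde h_i^+(z)$, where $\boldsymbol x_i^\pm(z)=\sum_{r\ge0}x_{ir}^\pm z^{-r-1}$ in $DY^{\mathsf c}(\mathfrak g)$ and $(z\pm\frac{\mathsf c}2)^{-r-1}$ is expanded in powers of $z^{-1}$. $\mathfrak t$ is the Lie algebra generated by $\mathbf C$ and the coefficients of $X_i^\pm(z)=\sum_{k\in\mathbb Z}X_{ik}^\pm z^{-k-1}$, $H_i(z)=\sum_{k\in\mathbb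 Z}H_{ik}z^{-k-1}$ ($i\in I$), with relations: $\mathbf C$ central; $[H_i(z),H_j(w)]=-2d_{ij}\delta_z(z,w)\mathbf C$; $[H_i(z),X_j^\pm(w)]=\pm2d_{ij}\delta(z,w)X_j^\pm(w)$; $[X_i^+(z),X_j^-(w)]=\delta_{ij}(\delta(z,w)H_i(z)-\delta_z(z,w)\mathbf C)$; $(z-w)[X_i^\pm(z),X_j^\pm(w)]=0$; $\mathrm{ad}(X_{i0}^\pm)^{1-a_{ij}}(X_j^\pm(z))=0$ for $i\ne j$; here $\delta_z(z,w)=\sum_{r\in\mathbb Z}rz^{r-1}w^{-r-1}$. $\phi_D:U(\mathfrak t)\to\mathrm{gr}_{\mathbb Z}DY^{\mathsf c}(\mathfrak g)$ is the algebra epimorphism sending $X_{ir}^\pm,H_{ir}$ to the classes of $x_{ir}^\pm,h_{ir}$ in $\mathbf F_r^D/\mathbf F_{r-1}^D$ and $\mathbf C$ to the class of $\mathsf c$ in $\mathbf F_0^D/\mathbf F_{-1}^D$. Spaces. $\mathcal V=\mathbb C[\mathcal H_{i,-r}]_{i\in I,r>0}\otimes\mathbb C_\varepsilon[Q]$. $\mathcal H_{i,-r}$ ($r>0$) acts by multiplication, $\mathcal H_{ir}$ ($r>0$) by $r\,\partial/\partial\mathcal H_{i,-r}$. $\varepsilon:Q\times Q\to\{\pm1\}$ is a fixed bimultiplicative function with $\varepsilon(\alpha,\alpha)=(-1)^{\frac12(\alpha,\alpha)}$; $\mathbb C_\varepsilon[Q]$ has basis $\{e^\alpha\}$, $e^\alpha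 e^\beta=\varepsilon(\alpha,\beta)e^{\alpha+\beta}$, acting by left multiplication on the second factor; $z^{\partial_\alpha}(f\otimes e^\beta)=z^{(\alpha,\beta)}f\otimes e^\beta$. $\mathcal V=\bigoplus_{n\in\mathbb Z}\mathcal V_n$ is graded by $\deg\mathcal H_{i,-r}=-r$, $\deg e^\alpha=-\frac12(\alpha,\alpha)$. $\mathrm{End}_m\mathcal V$ is the space of operators of degree $m$; $\widetilde{\mathrm{End}}_{\mathbb C}\mathcal V=\{\sum_mA_m\in\prod_m\mathrm{End}_m\mathcal V:A_m=0\text{ for }m\gg0\}$, filtered by $\mathbf F_k(\mathcal V)=\prod_{m\le k}\mathrm{End}_m\mathcal V$, with associated graded algebra $\bigoplus_m\mathrm{End}_m\mathcal V\subset\mathrm{End}_{\mathbb C}\mathcal V$. The morphism $\rho$ is the algebra homomorphism with $x_i^\pm(z)\mapsto\pm A_i^\pm(z)B_i^\pm(z)e^{\pm\alpha_i}z^{\partial_{\pm\alpha_i}}$ and $\mathsf c\mapsto1$, where, with $N(i)=\{j\neq i:a_{ij}\ne0\}$, $$A_i^\pm(z)=\exp\Big(\pm\sum_{r>0}\tfrac{\mathcal H_{i,-r}}r(z^r+(z\mp1)^r)\mp\sum_{r>0}\sum_{j\in N(i)}\tfrac{\mathcal H_{j,-r}}r(z\mp\tfrac12)^r\Big),\quad B_i^\pm(z)=\exp\Big(\mp\sum_{r>0}\tfrac{\mathcal H_{ir}}rz^{-r}\Big);$$ each coefficient of this series in $z$ is an infinite sum of homogeneous operators with degrees bounded above, hence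 an element of $\widetilde{\mathrm{End}}_{\mathbb C}\mathcal V$ (and $DY^{\mathsf c}(\mathfrak g)$ is generated by the $x_{ir}^\pm$). *)

theory Defs
  imports
    "HOL-Library.Poly_Mapping"
    "HOL-Computational_Algebra.Polynomial"
    "HOL-Combinatorics.Permutations"
    "HOL-Algebra.QuotRing"
    "HOL-Algebra.Module"
begin

section \<open>Associative algebras over the complex numbers\<close>

text \<open>Algebras are \<open>module\<close> records of HOL-Algebra with scalars of type \<^typ>\<open>complex\<close>; the locale
  \<open>algebra\<close> of that library is about commutative algebras and is not used.\<close>

type_synonym 'a calg = "(complex, 'a) module"

definition alg_hom :: "'a calg \<Rightarrow> 'b calg \<Rightarrow> ('a \<Rightarrow> 'b) set" where
  "alg_hom A B = {f \<in> ring_hom A B. \<forall>c. \<forall>x\<in>carrier A. f (c \<odot>\<^bsub>A\<^esub> x) = c \<odot>\<^bsub>B\<^esub> f x}"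

definition quot_alg :: "'a calg \<Rightarrow> 'a set \<Rightarrow> 'a set calg" where
  "quot_alg A I = \<lparr>carrier = carrier (A Quot I), monoid.mult = monoid.mult (A Quot I),
     one = one (A Quot I), zero = zero (A Quot I), add = add (A Quot I),
     module.smult = (\<lambda>c X. \<Union>x\<in>X. I +>\<^bsub>A\<^esub> (c \<odot>\<^bsub>A\<^esub> x))\<rparr>"

definition pscale :: "complex \<Rightarrow> ('k \<Rightarrow>\<^sub>0 complex) \<Rightarrow> ('k \<Rightarrow>\<^sub>0 complex)" (infixr \<open>\<cdot>\<close> 75) where
  "c \<cdot> x = Poly_Mapping.map ((*) c) x"

subsection \<open>Free algebras and presentations\<close>

datatype 'g fmon = FMon (letters: "'g list")

instantiation fmon :: (type) monoid_add
begin
definition zero_fmon :: "'a fmon" where "0 = FMon []"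
definition plus_fmon :: "'a fmon \<Rightarrow> 'a fmon \<Rightarrow> 'a fmon" where
  "u + v = FMon (letters u @ letters v)"
instance
  by standard (simp_all add: zero_fmon_def plus_fmon_def)
end

text \<open>The monoid algebra of the free monoid; \<open>S\<close> is the set of letters that may occur.\<close>

type_synonym 'g falg = "'g fmon \<Rightarrow>\<^sub>0 complex"

definition free_alg :: "'g set \<Rightarrow> 'g falg calg" where
  "free_alg S = \<lparr>carrier = {x. \<forall>w\<in>Poly_Mapping.keys x. set (letters w) \<subseteq> S},
     monoid.mult = (*), one = 1, zero = 0, add = (+), module.smult = (\<cdot>)\<rparr>"

definition gen :: "'g \<Rightarrow> 'g falg" where
  "gen g = Poly_Mapping.single (FMon [g]) 1"

definition pres_alg :: "'g set \<Rightarrow> 'g falg set \<Rightarrow> 'g falg set calg" where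
  "pres_alg S R = quot_alg (free_alg S) (genideal (free_alg S) R)"

definition pres_cls :: "'g set \<Rightarrow> 'g falg set \<Rightarrow> 'g falg \<Rightarrow> 'g falg set" where
  "pres_cls S R x = genideal (free_alg S) R +>\<^bsub>free_alg S\<^esub> x"

text \<open>The span of the monomials of degree at most \<open>k\<close> in generators \<open>g\<close> of degree \<open>dg g\<close>.\<close>

definition pres_filt :: "'g set \<Rightarrow> 'g falg set \<Rightarrow> ('g \<Rightarrow> int) \<Rightarrow> int \<Rightarrow> 'g falg set set" where
  "pres_filt S R dg k = pres_cls S R `
     {x \<in> carrier (free_alg S). \<forall>w\<in>Poly_Mapping.keys x. (\<Sum>g\<leftarrow>letters w. dg g) \<le> k}"

subsection \<open>Filtered algebras and associated graded algebras\<close>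

definition filtered_hom ::
    "'a calg \<Rightarrow> (int \<Rightarrow> 'a set) \<Rightarrow> 'b calg \<Rightarrow> (int \<Rightarrow> 'b set) \<Rightarrow> ('a \<Rightarrow> 'b) \<Rightarrow> bool" where
  "filtered_hom A F B G f \<longleftrightarrow> f \<in> alg_hom A B \<and> (\<forall>k. f ` F k \<subseteq> G k)"

text \<open>An element of the associated graded algebra is a family of cosets \<open>g k \<in> F k / F (k - 1)\<close>,
  almost all of them zero. The component of degree \<open>m\<close> of a product is the sum over \<open>k\<close> of the
  products of the components of degrees \<open>k\<close> and \<open>m - k\<close>.\<close>

definition gr_alg :: "'a calg \<Rightarrow> (int \<Rightarrow> 'a set) \<Rightarrow> (int \<Rightarrow> 'a set) calg" where
  "gr_alg A F = \<lparr>
     carrier = {g. (\<forall>k. g k \<in> (\<lambda>a. F (k - 1) +>\<^bsub>A\<^esub> a) ` F k) \<and> finite {k. g k \<noteq> F (k - 1)}},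
     monoid.mult = (\<lambda>g h m. \<Union>{F (m - 1) +>\<^bsub>A\<^esub>
          (\<Oplus>\<^bsub>A\<^esub>k\<in>{k. g k \<noteq> F (k - 1)}. a k \<otimes>\<^bsub>A\<^esub> b (m - k)) |
          a b. (\<forall>k. a k \<in> g k) \<and> (\<forall>k. b k \<in> h k)}),
     one = (\<lambda>k. F (k - 1) +>\<^bsub>A\<^esub> (if k = 0 then \<one>\<^bsub>A\<^esub> else \<zero>\<^bsub>A\<^esub>)),
     zero = (\<lambda>k. F (k - 1)),
     add = (\<lambda>g h k. g k <+>\<^bsub>A\<^esub> h k),
     module.smult = (\<lambda>c g k. \<Union>x\<in>g k. F (k - 1) +>\<^bsub>A\<^esub> (c \<odot>\<^bsub>A\<^esub> x))\<rparr>"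

text \<open>The class of \<open>a \<in> F k\<close> in the summand \<open>F k / F (k - 1)\<close>.\<close>

definition gr_cls :: "'a calg \<Rightarrow> (int \<Rightarrow> 'a set) \<Rightarrow> int \<Rightarrow> 'a \<Rightarrow> int \<Rightarrow> 'a set" where
  "gr_cls A F k a = (\<lambda>m. F (m - 1) +>\<^bsub>A\<^esub> (if m = k then a else \<zero>\<^bsub>A\<^esub>))"

definition gr_map :: "'b calg \<Rightarrow> (int \<Rightarrow> 'b set) \<Rightarrow> ('a \<Rightarrow> 'b) \<Rightarrow> (int \<Rightarrow> 'a set) \<Rightarrow> int \<Rightarrow> 'b set" where
  "gr_map B G f g = (\<lambda>k. \<Union>x\<in>g k. G (k - 1) +>\<^bsub>B\<^esub> f x)"

section \<open>Lie algebras by generators and relations, enveloping algebras\<close>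

text \<open>The free Lie algebra is the free non-associative algebra on the generators modulo the ideal
  forced by alternation and the Jacobi identity.\<close>

datatype 'g mag = Leaf 'g | Br "'g mag" "'g mag"

type_synonym 'g nalg = "'g mag \<Rightarrow>\<^sub>0 complex"

definition lgen :: "'g \<Rightarrow> 'g nalg" where
  "lgen g = Poly_Mapping.single (Leaf g) 1"

definition brk :: "'g nalg \<Rightarrow> 'g nalg \<Rightarrow> 'g nalg" where
  "brk x y = (\<Sum>s\<in>Poly_Mapping.keys x. \<Sum>t\<in>Poly_Mapping.keys y.
     Poly_Mapping.single (Br s t) (Poly_Mapping.lookup x s * Poly_Mapping.lookup y t))"

inductive_set lie_ideal :: "'g nalg set \<Rightarrow> 'g nalg set" for R where
  rel: "x \<in> R \<Longrightarrow> x \<in> lie_ideal R"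
| alternating: "brk x x \<in> lie_ideal R"
| jacobi: "brk x (brk y z) + brk y (brk z x) + brk z (brk x y) \<in> lie_ideal R"
| zero: "0 \<in> lie_ideal R"
| add: "x \<in> lie_ideal R \<Longrightarrow> y \<in> lie_ideal R \<Longrightarrow> x + y \<in> lie_ideal R"
| scale: "x \<in> lie_ideal R \<Longrightarrow> c \<cdot> x \<in> lie_ideal R"
| left: "x \<in> lie_ideal R \<Longrightarrow> brk y x \<in> lie_ideal R"
| right: "x \<in> lie_ideal R \<Longrightarrow> brk x y \<in> lie_ideal R"

text \<open>The Lie algebra presented by \<open>R\<close> is the set of classes \<open>lie_cls R x\<close>, with the operations
  induced on classes by \<open>+\<close>, \<open>\<cdot>\<close> and \<open>brk\<close>.\<close>

definition lie_cls :: "'g nalg set \<Rightarrow> 'g nalg \<Rightarrow> 'g nalg set" where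
  "lie_cls R x = {x + u |u. u \<in> lie_ideal R}"

definition comm :: "'a::ring_1 \<Rightarrow> 'a \<Rightarrow> 'a" where
  "comm x y = x * y - y * x"

inductive_set env_rels :: "'g nalg set \<Rightarrow> 'g nalg set falg set" for R where
  "gen (lie_cls R (x + y)) - gen (lie_cls R x) - gen (lie_cls R y) \<in> env_rels R"
| "gen (lie_cls R (c \<cdot> x)) - c \<cdot> gen (lie_cls R x) \<in> env_rels R"
| "gen (lie_cls R (brk x y)) - comm (gen (lie_cls R x)) (gen (lie_cls R y)) \<in> env_rels R"

definition env_alg :: "'g nalg set \<Rightarrow> 'g nalg set falg set calg" where
  "env_alg R = pres_alg (range (lie_cls R)) (env_rels R)"

text \<open>The canonical map from the Lie algebra to its enveloping algebra, at the class of \<open>x\<close>.\<close>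

definition env_in :: "'g nalg set \<Rightarrow> 'g nalg \<Rightarrow> 'g nalg set falg set" where
  "env_in R x = pres_cls (range (lie_cls R)) (env_rels R) (gen (lie_cls R x))"

section \<open>Root data\<close>

datatype pm = Pl | Mi

definition sg :: "pm \<Rightarrow> 'a::ring_1" where
  "sg s = (case s of Pl \<Rightarrow> 1 | Mi \<Rightarrow> - 1)"

text \<open>The last condition is indecomposability.\<close>

definition simply_laced :: "('i::finite \<Rightarrow> 'i \<Rightarrow> int) \<Rightarrow> bool" where
  "simply_laced A \<longleftrightarrow>
     (\<forall>i. A i i = 2) \<and> (\<forall>i j. i \<noteq> j \<longrightarrow> A i j \<in> {0, - 1}) \<and> (\<forall>i j. A i j = A j i) \<and>
     (\<forall>J. J \<noteq> {} \<and> J \<noteq> UNIV \<longrightarrow> (\<exists>i\<in>J. \<exists>j\<in>- J. A i j \<noteq> 0))"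

type_synonym 'i rootlat = "'i \<Rightarrow>\<^sub>0 int"

definition simple_root :: "'i \<Rightarrow> 'i rootlat" where
  "simple_root i = Poly_Mapping.single i 1"

definition form :: "('i::finite \<Rightarrow> 'i \<Rightarrow> int) \<Rightarrow> 'i rootlat \<Rightarrow> 'i rootlat \<Rightarrow> int" where
  "form A \<alpha> \<beta> = (\<Sum>i\<in>UNIV. \<Sum>j\<in>UNIV. Poly_Mapping.lookup \<alpha> i * A i j * Poly_Mapping.lookup \<beta> j)"

definition dd :: "('i::finite \<Rightarrow> 'i \<Rightarrow> int) \<Rightarrow> 'i \<Rightarrow> 'i \<Rightarrow> complex" where
  "dd A i j = of_int (form A (simple_root i) (simple_root j)) / 2"

definition cocycle ::
    "('i::finite \<Rightarrow> 'i \<Rightarrow> int) \<Rightarrow> ('i rootlat \<Rightarrow> 'i rootlat \<Rightarrow> complex) \<Rightarrow> bool" where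
  "cocycle A \<epsilon> \<longleftrightarrow>
     (\<forall>\<alpha> \<beta>. \<epsilon> \<alpha> \<beta> \<in> {1, - 1}) \<and>
     (\<forall>\<alpha> \<beta> \<gamma>. \<epsilon> (\<alpha> + \<beta>) \<gamma> = \<epsilon> \<alpha> \<gamma> * \<epsilon> \<beta> \<gamma>) \<and>
     (\<forall>\<alpha> \<beta> \<gamma>. \<epsilon> \<alpha> (\<beta> + \<gamma>) = \<epsilon> \<alpha> \<beta> * \<epsilon> \<alpha> \<gamma>) \<and>
     (\<forall>\<alpha>. \<epsilon> \<alpha> \<alpha> = (- 1) powi (form A \<alpha> \<alpha> div 2))"

section \<open>Formal distributions\<close>

text \<open>A formal distribution in \<open>z\<close> is the function sending \<open>p\<close> to the coefficient of \<open>z\<^sup>p\<close>; one in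
  \<open>z\<close> and \<open>w\<close> sends \<open>p\<close>, \<open>q\<close> to the coefficient of \<open>z\<^sup>p w\<^sup>q\<close>. Hence \<open>x\<^sub>r\<close> in \<open>\<Sum> x\<^sub>r z\<^bsup>-r-1\<^esup>\<close>
  sits at \<open>p = - r - 1\<close>.\<close>

definition zw :: "(int \<Rightarrow> int \<Rightarrow> 'a::ab_group_add) \<Rightarrow> int \<Rightarrow> int \<Rightarrow> 'a" where
  "zw D p q = D (p - 1) q - D p (q - 1)"

text \<open>\<open>zwa a D\<close> is \<open>(z - w + a) D(z, w)\<close>.\<close>

definition zwa :: "'a::ring_1 \<Rightarrow> (int \<Rightarrow> int \<Rightarrow> 'a) \<Rightarrow> int \<Rightarrow> int \<Rightarrow> 'a" where
  "zwa a D p q = zw D p q + a * D p q"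

definition delta :: "int \<Rightarrow> int \<Rightarrow> 'a::ring_1" where
  "delta p q = (if p + q = - 1 then 1 else 0)"

text \<open>The coefficient of \<open>w\<^sup>q\<close> in \<open>(w + a)\<^sup>r\<close>, expanded in nonnegative powers of \<open>a w\<^bsup>-1\<^esup>\<close>.\<close>

definition pw :: "'g falg \<Rightarrow> int \<Rightarrow> int \<Rightarrow> 'g falg" where
  "pw a r q = (if q \<le> r then ((of_int r :: complex) gchoose nat (r - q)) \<cdot> a ^ nat (r - q) else 0)"

text \<open>\<open>shift a f\<close> is \<open>f(w + a)\<close>, for \<open>f\<close> with exponents bounded above.\<close>

definition shift :: "'g falg \<Rightarrow> (int \<Rightarrow> 'g falg) \<Rightarrow> int \<Rightarrow> 'g falg" where
  "shift a f q = Sum_any (\<lambda>n. f n * pw a n q)"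

section \<open>The centrally extended Yangian double\<close>

text \<open>The same index type serves for the generators of the Lie algebra \<open>\<tt>\<close> below.\<close>

datatype 'i dgen = GC | GX pm 'i int | GH 'i int

definition cc :: "'i dgen falg" where
  "cc = gen GC"

definition xf :: "pm \<Rightarrow> 'i \<Rightarrow> int \<Rightarrow> 'i dgen falg" where
  "xf s i p = gen (GX s i (- p - 1))"

definition hp :: "'i \<Rightarrow> int \<Rightarrow> 'i dgen falg" where
  "hp i p = (if - p - 1 \<ge> 0 then gen (GH i (- p - 1)) else 0)"

definition hm :: "'i \<Rightarrow> int \<Rightarrow> 'i dgen falg" where
  "hm i p = (if - p - 1 < 0 then gen (GH i (- p - 1)) else 0)"

definition cij :: "('i::finite \<Rightarrow> 'i \<Rightarrow> int) \<Rightarrow> pm \<Rightarrow> 'i \<Rightarrow> 'i \<Rightarrow> 'i dgen falg" where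
  "cij A s i j = dd A i j \<cdot> 1 + (sg s / 2) \<cdot> cc"

text \<open>A factor \<open>(z - w)\<^sup>2 - a\<^sup>2\<close> is applied as \<open>zw (zw D) p q - a\<^sup>2 * D p q\<close>.\<close>

inductive_set dy_rels :: "('i::finite \<Rightarrow> 'i \<Rightarrow> int) \<Rightarrow> 'i dgen falg set" for A where
  central: "comm cc (gen g) \<in> dy_rels A"
| hh_plus: "comm (hp i p) (hp j q) \<in> dy_rels A"
| hh_minus: "comm (hm i p) (hm j q) \<in> dy_rels A"
| hh_mixed:
  "(zw (zw (\<lambda>p q. hm j q * hp i p)) p q - (cij A Pl i j)\<^sup>2 * (hm j q * hp i p))
   - (zw (zw (\<lambda>p q. hp i p * hm j q)) p q - (cij A Mi i j)\<^sup>2 * (hp i p * hm j q))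
   - ((if p = 0 \<and> q = 0 then - ((2 * dd A i j) \<cdot> cc) else 0)
      + (2 * dd A i j) \<cdot> (((if p = 0 then hm j q else 0) - (if q = 0 then hp i p else 0)) * cc))
   \<in> dy_rels A"
| hx_plus:
  "zwa (- (sg s * cij A Mi i j)) (\<lambda>p q. hp i p * xf s j q) p q
   - zwa (sg s * cij A Pl i j) (\<lambda>p q. xf s j q * hp i p) p q
   - (if p = 0 then (2 * sg s * dd A i j) \<cdot> xf s j q else 0) \<in> dy_rels A"
| hx_minus:
  "zwa ((sg s * dd A i j) \<cdot> 1) (\<lambda>p q. xf s j q * hm i p) p q
   - zwa (- ((sg s * dd A i j) \<cdot> 1)) (\<lambda>p q. hm i p * xf s j q) p q
   - (if p = 0 then (2 * sg s * dd A i j) \<cdot> xf s j q else 0) \<in> dy_rels A"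
| xx_same:
  "zwa (- ((sg s * dd A i j) \<cdot> 1)) (\<lambda>p q. xf s i p * xf s j q) p q
   - zwa ((sg s * dd A i j) \<cdot> 1) (\<lambda>p q. xf s j q * xf s i p) p q \<in> dy_rels A"
| xx_mixed:
  "comm (xf Pl i p) (xf Mi j q)
   - (if i = j then
        pw cc (- p - 1) q - delta p q
        + Sum_any (\<lambda>k. pw cc (- p - 1) k * shift ((1 / 2) \<cdot> cc) (hp i) (q - k))
        + Sum_any (\<lambda>k. delta k q * hm i (p - k))
      else 0) \<in> dy_rels A"
| serre:
  "i \<noteq> j \<Longrightarrow> m = nat (1 - A i j) \<Longrightarrow>
   (\<Sum>\<sigma> | \<sigma> permutes {..<m}. foldr (\<lambda>k. comm (gen (GX s i (rs (\<sigma> k))))) [0..<m] (gen (GX s j r)))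
   \<in> dy_rels A"

definition DY :: "('i::finite \<Rightarrow> 'i \<Rightarrow> int) \<Rightarrow> 'i dgen falg set calg" where
  "DY A = pres_alg UNIV (dy_rels A)"

definition dy :: "('i::finite \<Rightarrow> 'i \<Rightarrow> int) \<Rightarrow> 'i dgen falg \<Rightarrow> 'i dgen falg set" where
  "dy A = pres_cls UNIV (dy_rels A)"

definition dy_deg :: "'i dgen \<Rightarrow> int" where
  "dy_deg g = (case g of GC \<Rightarrow> 0 | GX s i r \<Rightarrow> r | GH i r \<Rightarrow> r)"

definition FD :: "('i::finite \<Rightarrow> 'i \<Rightarrow> int) \<Rightarrow> int \<Rightarrow> 'i dgen falg set set" where
  "FD A = pres_filt UNIV (dy_rels A) dy_deg"

section \<open>The Yangian\<close>

datatype 'i ygen = YX pm 'i nat | YH 'i nat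

abbreviation yx :: "pm \<Rightarrow> 'i \<Rightarrow> nat \<Rightarrow> 'i ygen falg" where
  "yx s i r \<equiv> gen (YX s i r)"

abbreviation yh :: "'i \<Rightarrow> nat \<Rightarrow> 'i ygen falg" where
  "yh i r \<equiv> gen (YH i r)"

inductive_set y_rels :: "('i::finite \<Rightarrow> 'i \<Rightarrow> int) \<Rightarrow> 'i ygen falg set" for A where
  "comm (yh i r) (yh j r') \<in> y_rels A"
| "comm (yh i 0) (yx s j r) - (2 * sg s * dd A i j) \<cdot> yx s j r \<in> y_rels A"
| "comm (yx Pl i r) (yx Mi j r') - (if i = j then yh i (r + r') else 0) \<in> y_rels A"
| "comm (yh i (Suc r)) (yx s j r') - comm (yh i r) (yx s j (Suc r'))
   - (sg s * dd A i j) \<cdot> (yh i r * yx s j r' + yx s j r' * yh i r) \<in> y_rels A"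
| "comm (yx s i (Suc r)) (yx s j r') - comm (yx s i r) (yx s j (Suc r'))
   - (sg s * dd A i j) \<cdot> (yx s i r * yx s j r' + yx s j r' * yx s i r) \<in> y_rels A"
| "i \<noteq> j \<Longrightarrow> m = nat (1 - A i j) \<Longrightarrow>
   (\<Sum>\<sigma> | \<sigma> permutes {..<m}. foldr (\<lambda>k. comm (yx s i (rs (\<sigma> k)))) [0..<m] (yx s j r)) \<in> y_rels A"

definition Y :: "('i::finite \<Rightarrow> 'i \<Rightarrow> int) \<Rightarrow> 'i ygen falg set calg" where
  "Y A = pres_alg UNIV (y_rels A)"

definition ycls :: "('i::finite \<Rightarrow> 'i \<Rightarrow> int) \<Rightarrow> 'i ygen falg \<Rightarrow> 'i ygen falg set" where
  "ycls A = pres_cls UNIV (y_rels A)"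

definition y_deg :: "'i ygen \<Rightarrow> int" where
  "y_deg g = (case g of YX s i r \<Rightarrow> int r | YH i r \<Rightarrow> int r)"

definition FY :: "('i::finite \<Rightarrow> 'i \<Rightarrow> int) \<Rightarrow> int \<Rightarrow> 'i ygen falg set set" where
  "FY A = pres_filt UNIV (y_rels A) y_deg"

text \<open>The bold series of the \<open>x\<^sub>i\<^sub>r\<close> with \<open>r \<ge> 0\<close>, and the coefficient of \<open>z\<^bsup>-r-1\<^esup>\<close> in its
  shift by \<open>\<plusminus> \<c>/2\<close>.\<close>

definition bx :: "pm \<Rightarrow> 'i \<Rightarrow> int \<Rightarrow> 'i dgen falg" where
  "bx s i p = (if - p - 1 \<ge> 0 then gen (GX s i (- p - 1)) else 0)"

definition iota_x :: "pm \<Rightarrow> 'i \<Rightarrow> nat \<Rightarrow> 'i dgen falg" where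
  "iota_x s i r = shift ((sg s / 2) \<cdot> cc) (bx s i) (- int r - 1)"

section \<open>The Lie algebra \<open>\<tt>\<close>\<close>

definition tX :: "pm \<Rightarrow> 'i \<Rightarrow> int \<Rightarrow> 'i dgen nalg" where
  "tX s i p = lgen (GX s i (- p - 1))"

definition tH :: "'i \<Rightarrow> int \<Rightarrow> 'i dgen nalg" where
  "tH i p = lgen (GH i (- p - 1))"

text \<open>The coefficient of \<open>z\<^sup>p w\<^sup>q\<close> in the derivative \<open>\<Sum> r z\<^bsup>r-1\<^esup> w\<^bsup>-r-1\<^esup>\<close> of the delta function.\<close>

definition delta_z :: "int \<Rightarrow> int \<Rightarrow> complex" where
  "delta_z p q = (if p + q = - 2 then of_int (p + 1) else 0)"

inductive_set t_rels :: "('i::finite \<Rightarrow> 'i \<Rightarrow> int) \<Rightarrow> 'i dgen nalg set" for A where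
  "brk (lgen GC) (lgen g) \<in> t_rels A"
| "brk (tH i p) (tH j q) + (2 * dd A i j * delta_z p q) \<cdot> lgen GC \<in> t_rels A"
| "brk (tH i p) (tX s j q)
   - (2 * sg s * dd A i j) \<cdot> Sum_any (\<lambda>k. delta p k \<cdot> tX s j (q - k)) \<in> t_rels A"
| "brk (tX Pl i p) (tX Mi j q)
   - (if i = j then Sum_any (\<lambda>k. delta k q \<cdot> tH i (p - k)) - delta_z p q \<cdot> lgen GC else 0)
   \<in> t_rels A"
| "zw (\<lambda>p q. brk (tX s i p) (tX s j q)) p q \<in> t_rels A"
| "i \<noteq> j \<Longrightarrow> (brk (lgen (GX s i 0)) ^^ nat (1 - A i j)) (tX s j p) \<in> t_rels A"

definition Ut :: "('i::finite \<Rightarrow> 'i \<Rightarrow> int) \<Rightarrow> 'i dgen nalg set falg set calg" where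
  "Ut A = env_alg (t_rels A)"

text \<open>The images in the enveloping algebra of the generators of \<open>\<tt>\<close>.\<close>

definition ut :: "('i::finite \<Rightarrow> 'i \<Rightarrow> int) \<Rightarrow> 'i dgen \<Rightarrow> 'i dgen nalg set falg set" where
  "ut A g = env_in (t_rels A) (lgen g)"

section \<open>The space \<open>\<V>\<close> and its operators\<close>

text \<open>\<open>hpoly\<close> is the polynomial ring in the \<open>\<H>\<^bsub>i,-r\<^esub>\<close>, \<open>r > 0\<close>; the variable with index \<open>(i, n)\<close>
  is \<open>\<H>\<^bsub>i,-(n+1)\<^esub>\<close>. In \<open>vsp\<close>, \<open>f \<otimes> e\<^sup>\<beta>\<close> is \<open>single \<beta> f\<close>.\<close>

type_synonym 'i hpoly = "('i \<times> nat \<Rightarrow>\<^sub>0 nat) \<Rightarrow>\<^sub>0 complex"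
type_synonym 'i vsp = "'i rootlat \<Rightarrow>\<^sub>0 'i hpoly"
type_synonym 'i vop = "'i vsp \<Rightarrow> 'i vsp"

definition vscale :: "complex \<Rightarrow> 'i vop" where
  "vscale c v = Poly_Mapping.map ((\<cdot>) c) v"

text \<open>For \<open>r > 0\<close>: the element \<open>\<H>\<^bsub>i,-r\<^esub>\<close>.\<close>

definition Hv :: "'i \<Rightarrow> nat \<Rightarrow> 'i hpoly" where
  "Hv i r = Poly_Mapping.single (Poly_Mapping.single (i, r - 1) 1) 1"

definition mulH :: "'i hpoly \<Rightarrow> 'i vop" where
  "mulH f v = Poly_Mapping.map ((*) f) v"

definition pdiff :: "'x \<Rightarrow> (('x \<Rightarrow>\<^sub>0 nat) \<Rightarrow>\<^sub>0 complex) \<Rightarrow> ('x \<Rightarrow>\<^sub>0 nat) \<Rightarrow>\<^sub>0 complex" where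
  "pdiff x f = (\<Sum>m\<in>Poly_Mapping.keys f.
     Poly_Mapping.single (m - Poly_Mapping.single x 1)
       (of_nat (Poly_Mapping.lookup m x) * Poly_Mapping.lookup f m))"

text \<open>For \<open>r > 0\<close>: the operator \<open>\<H>\<^sub>i\<^sub>r\<close>.\<close>

definition annH :: "'i \<Rightarrow> nat \<Rightarrow> 'i vop" where
  "annH i r v = Poly_Mapping.map (\<lambda>f. of_nat r \<cdot> pdiff (i, r - 1) f) v"

definition eop :: "('i rootlat \<Rightarrow> 'i rootlat \<Rightarrow> complex) \<Rightarrow> 'i rootlat \<Rightarrow> 'i vop" where
  "eop \<epsilon> \<alpha> v = (\<Sum>\<beta>\<in>Poly_Mapping.keys v.
     Poly_Mapping.single (\<alpha> + \<beta>) (\<epsilon> \<alpha> \<beta> \<cdot> Poly_Mapping.lookup v \<beta>))"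

text \<open>The coefficient of \<open>z\<^sup>p\<close> in the operator \<open>z\<close> to the power \<open>\<partial>\<^sub>\<alpha>\<close>.\<close>

definition zpow :: "('i::finite \<Rightarrow> 'i \<Rightarrow> int) \<Rightarrow> 'i rootlat \<Rightarrow> int \<Rightarrow> 'i vop" where
  "zpow A \<alpha> p v = (\<Sum>\<beta> | \<beta> \<in> Poly_Mapping.keys v \<and> form A \<alpha> \<beta> = p.
     Poly_Mapping.single \<beta> (Poly_Mapping.lookup v \<beta>))"

definition vlinear :: "'i vop \<Rightarrow> bool" where
  "vlinear T \<longleftrightarrow> Vector_Spaces.linear vscale vscale T"

definition EndV :: "'i vop calg" where
  "EndV = \<lparr>carrier = {T. vlinear T}, monoid.mult = (\<circ>), one = id, zero = (\<lambda>v. 0),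
     add = (\<lambda>S T v. S v + T v), module.smult = (\<lambda>c T v. vscale c (T v))\<rparr>"

subsection \<open>Grading and completed endomorphism algebra\<close>

definition vdeg :: "('i::finite \<Rightarrow> 'i \<Rightarrow> int) \<Rightarrow> 'i rootlat \<Rightarrow> ('i \<times> nat \<Rightarrow>\<^sub>0 nat) \<Rightarrow> int" where
  "vdeg A \<beta> m = - (\<Sum>x\<in>Poly_Mapping.keys m. int (Poly_Mapping.lookup m x) * (int (snd x) + 1))
     - form A \<beta> \<beta> div 2"

definition Vgr :: "('i::finite \<Rightarrow> 'i \<Rightarrow> int) \<Rightarrow> int \<Rightarrow> 'i vsp set" where
  "Vgr A n = {v. \<forall>\<beta>. \<forall>m\<in>Poly_Mapping.keys (Poly_Mapping.lookup v \<beta>). vdeg A \<beta> m = n}"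

definition Endm :: "('i::finite \<Rightarrow> 'i \<Rightarrow> int) \<Rightarrow> int \<Rightarrow> 'i vop set" where
  "Endm A m = {T. vlinear T \<and> (\<forall>n. T ` Vgr A n \<subseteq> Vgr A (n + m))}"

text \<open>Elements of the completed algebra are the families of their homogeneous components.\<close>

definition tEnd :: "('i::finite \<Rightarrow> 'i \<Rightarrow> int) \<Rightarrow> (int \<Rightarrow> 'i vop) calg" where
  "tEnd A = \<lparr>
     carrier = {T. (\<forall>m. T m \<in> Endm A m) \<and> (\<exists>N. \<forall>m>N. T m = (\<lambda>v. 0))},
     monoid.mult = (\<lambda>S T m v.
        \<Sum>k | S k \<noteq> (\<lambda>v. 0) \<and> T (m - k) \<noteq> (\<lambda>v. 0). S k (T (m - k) v)),
     one = (\<lambda>m. if m = 0 then id else (\<lambda>v. 0)),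
     zero = (\<lambda>m v. 0),
     add = (\<lambda>S T m v. S m v + T m v),
     module.smult = (\<lambda>c T m v. vscale c (T m v))\<rparr>"

definition FV :: "('i::finite \<Rightarrow> 'i \<Rightarrow> int) \<Rightarrow> int \<Rightarrow> (int \<Rightarrow> 'i vop) set" where
  "FV A k = {T \<in> carrier (tEnd A). \<forall>m>k. T m = (\<lambda>v. 0)}"

text \<open>The embedding of the associated graded algebra of \<open>tEnd A\<close> into \<open>EndV\<close>: a class in
  \<open>FV A m / FV A (m - 1)\<close> goes to the common component of degree \<open>m\<close> of its elements.\<close>

definition gr_to_End :: "('i::finite \<Rightarrow> 'i \<Rightarrow> int) \<Rightarrow> (int \<Rightarrow> (int \<Rightarrow> 'i vop) set) \<Rightarrow> 'i vop" where
  "gr_to_End A g v = (\<Sum>m | g m \<noteq> FV A (m - 1). the_elem ((\<lambda>T. T m) ` g m) v)"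

definition gr_rho :: "('i::finite \<Rightarrow> 'i \<Rightarrow> int) \<Rightarrow> ('a \<Rightarrow> int \<Rightarrow> 'i vop) \<Rightarrow> (int \<Rightarrow> 'a set) \<Rightarrow> 'i vop" where
  "gr_rho A \<rho> g = gr_to_End A (gr_map (tEnd A) (FV A) \<rho> g)"

section \<open>Vertex operators\<close>

text \<open>In \<open>exp (\<Sum>\<^bsub>r>0\<^esub> a\<^sub>r)\<close> with \<open>a\<^sub>r\<close> of weight \<open>r\<close>, the part of weight \<open>n\<close> is the sum over the
  compositions \<open>r\<^sub>1 + \<dots> + r\<^sub>k = n\<close> of \<open>1/k!\<close> times the product of the \<open>a\<close> at \<open>r\<^sub>1\<close>, \<open>\<dots>\<close>, \<open>r\<^sub>k\<close>.\<close>

definition compositions :: "nat \<Rightarrow> nat list set" where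
  "compositions n = {rs. 0 \<notin> set rs \<and> sum_list rs = n}"

definition exp_op :: "(nat \<Rightarrow> 'i vop) \<Rightarrow> nat \<Rightarrow> 'i vop" where
  "exp_op a n v = (\<Sum>rs\<in>compositions n. vscale (1 / fact (length rs)) (foldr a rs v))"

definition exp_poly :: "(nat \<Rightarrow> 'i hpoly poly) \<Rightarrow> nat \<Rightarrow> 'i hpoly poly" where
  "exp_poly a n =
     (\<Sum>rs\<in>compositions n. Polynomial.smult ((1 / fact (length rs)) \<cdot> 1) (prod_list (map a rs)))"

text \<open>The \<open>r\<close>-th summand of the exponent of \<open>A\<^sub>i\<close>: a polynomial in \<open>z\<close>, linear in the
  \<open>\<H>\<^bsub>j,-r\<^esub>\<close> and thus of degree \<open>- r\<close> as an operator.\<close>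

definition Aexponent :: "('i::finite \<Rightarrow> 'i \<Rightarrow> int) \<Rightarrow> pm \<Rightarrow> 'i \<Rightarrow> nat \<Rightarrow> 'i hpoly poly" where
  "Aexponent A s i r =
     Polynomial.smult ((sg s / of_nat r) \<cdot> Hv i r) ([:0, 1:] ^ r + [:- sg s \<cdot> 1, 1:] ^ r)
     - (\<Sum>j | j \<noteq> i \<and> A i j \<noteq> 0.
          Polynomial.smult ((sg s / of_nat r) \<cdot> Hv j r) ([:- (sg s / 2) \<cdot> 1, 1:] ^ r))"

text \<open>Series with coefficients in \<open>EndV\<close> have type \<^typ>\<open>int \<Rightarrow> 'i vop\<close> (exponent of \<open>z\<close>), those with
  coefficients in \<open>tEnd A\<close> type \<^typ>\<open>int \<Rightarrow> int \<Rightarrow> 'i vop\<close> (exponent of \<open>z\<close>, degree of the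
  component). Products are evaluated on vectors, where all sums are finite.\<close>

definition ser_prod :: "(int \<Rightarrow> 'i vop) \<Rightarrow> (int \<Rightarrow> 'i vop) \<Rightarrow> int \<Rightarrow> 'i vop" where
  "ser_prod F G p v = Sum_any (\<lambda>q. F q (G (p - q) v))"

definition tser_prod ::
    "(int \<Rightarrow> int \<Rightarrow> 'i vop) \<Rightarrow> (int \<Rightarrow> int \<Rightarrow> 'i vop) \<Rightarrow> int \<Rightarrow> int \<Rightarrow> 'i vop" where
  "tser_prod F G p m v = Sum_any (\<lambda>(q, l). F q l (G (p - q) (m - l) v))"

definition Vproj :: "('i::finite \<Rightarrow> 'i \<Rightarrow> int) \<Rightarrow> int \<Rightarrow> 'i vop" where
  "Vproj A n v = (\<Sum>\<beta>\<in>Poly_Mapping.keys v.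
     \<Sum>m | m \<in> Poly_Mapping.keys (Poly_Mapping.lookup v \<beta>) \<and> vdeg A \<beta> m = n.
       Poly_Mapping.single \<beta> (Poly_Mapping.single m (Poly_Mapping.lookup (Poly_Mapping.lookup v \<beta>) m)))"

text \<open>The homogeneous components of the coefficients of a series over \<open>EndV\<close>.\<close>

definition hcomps :: "('i::finite \<Rightarrow> 'i \<Rightarrow> int) \<Rightarrow> (int \<Rightarrow> 'i vop) \<Rightarrow> int \<Rightarrow> int \<Rightarrow> 'i vop" where
  "hcomps A F p m v = Sum_any (\<lambda>n. Vproj A (n + m) (F p (Vproj A n v)))"

definition Aser :: "('i::finite \<Rightarrow> 'i \<Rightarrow> int) \<Rightarrow> pm \<Rightarrow> 'i \<Rightarrow> int \<Rightarrow> int \<Rightarrow> 'i vop" where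
  "Aser A s i p m = (if p \<ge> 0 \<and> m \<le> 0
     then mulH (coeff (exp_poly (Aexponent A s i) (nat (- m))) (nat p)) else (\<lambda>v. 0))"

definition Bser :: "pm \<Rightarrow> 'i \<Rightarrow> int \<Rightarrow> 'i vop" where
  "Bser s i p = (if p \<le> 0
     then exp_op (\<lambda>r v. vscale (- sg s / of_nat r) (annH i r v)) (nat (- p)) else (\<lambda>v. 0))"

text \<open>The series \<open>e\<^sup>\<alpha> z\<^bsup>\<partial>\<alpha>\<^esup>\<close> for \<open>\<alpha> = \<plusminus>\<alpha>\<^sub>i\<close>.\<close>

definition Eser :: "('i::finite \<Rightarrow> 'i \<Rightarrow> int) \<Rightarrow> ('i rootlat \<Rightarrow> 'i rootlat \<Rightarrow> complex) \<Rightarrow>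
    pm \<Rightarrow> 'i \<Rightarrow> int \<Rightarrow> 'i vop" where
  "Eser A \<epsilon> s i p = (let \<alpha> = (case s of Pl \<Rightarrow> simple_root i | Mi \<Rightarrow> - simple_root i)
     in eop \<epsilon> \<alpha> \<circ> zpow A \<alpha> p)"

text \<open>The coefficient of \<open>z\<^bsup>-r-1\<^esup>\<close> in the series prescribed for \<open>\<rho>\<close>, as an element of \<open>tEnd A\<close>.\<close>

definition rho_x :: "('i::finite \<Rightarrow> 'i \<Rightarrow> int) \<Rightarrow> ('i rootlat \<Rightarrow> 'i rootlat \<Rightarrow> complex) \<Rightarrow>
    pm \<Rightarrow> 'i \<Rightarrow> int \<Rightarrow> int \<Rightarrow> 'i vop" where
  "rho_x A \<epsilon> s i r = (\<lambda>m v. vscale (sg s)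
     (tser_prod (Aser A s i) (tser_prod (hcomps A (Bser s i)) (hcomps A (Eser A \<epsilon> s i))) (- r - 1) m v))"

definition Htilde :: "('i::finite \<Rightarrow> 'i \<Rightarrow> int) \<Rightarrow> 'i \<Rightarrow> nat \<Rightarrow> 'i hpoly" where
  "Htilde A i r = (\<Sum>j\<in>UNIV. of_int (form A (simple_root i) (simple_root j)) \<cdot> Hv j r)"

definition Aring_ser :: "('i::finite \<Rightarrow> 'i \<Rightarrow> int) \<Rightarrow> pm \<Rightarrow> 'i \<Rightarrow> int \<Rightarrow> 'i vop" where
  "Aring_ser A s i p = (if p \<ge> 0
     then exp_op (\<lambda>r. mulH ((sg s / of_nat r) \<cdot> Htilde A i r)) (nat p) else (\<lambda>v. 0))"

text \<open>The coefficient of \<open>z\<^bsup>-r-1\<^esup>\<close> in the leading-term vertex operator.\<close>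

definition Xring :: "('i::finite \<Rightarrow> 'i \<Rightarrow> int) \<Rightarrow> ('i rootlat \<Rightarrow> 'i rootlat \<Rightarrow> complex) \<Rightarrow>
    pm \<Rightarrow> 'i \<Rightarrow> int \<Rightarrow> 'i vop" where
  "Xring A \<epsilon> s i r = (\<lambda>v. vscale (sg s)
     (ser_prod (Aring_ser A s i) (ser_prod (Bser s i) (Eser A \<epsilon> s i)) (- r - 1) v))"

end

theory Submission
  imports Defs
begin

text \<open>The generators \<open>h\<^sub>i\<^sub>r\<close> lie in the filtration step \<open>r\<close> because the commutator \<open>[x\<^sub>i\<^sub>0\<^sup>+, x\<^sub>i\<^sup>-(w)]\<close>
  expresses them through the \<open>x\<close>'s, by induction on \<open>r\<close> for \<open>r \<ge> 0\<close>; so only the vertex operators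
  matter. There the coefficient of \<open>z\<^sup>p\<close> in \<open>B\<close> has degree \<open>- p\<close> and the one in \<open>e\<^sup>\<alpha> z\<^bsup>\<partial>\<alpha>\<^esup>\<close> has degree
  \<open>- p - 1\<close>, whereas the part of \<open>A\<close> of degree \<open>- n\<close> is a polynomial in \<open>z\<close> of degree at most \<open>n\<close>.
  Hence the coefficient of \<open>z\<^bsup>-r-1\<^esup>\<close> in the product has degree at most \<open>r\<close>, and its part of degree \<open>r\<close>
  is obtained by replacing the shifts \<open>z - a\<close> in the exponent of \<open>A\<close> by \<open>z\<close>. The representation is
  determined by these operators because \<open>\<tt>\<close> is generated by the \<open>X\<^sub>i\<^sub>r\<close>.\<close>

section \<open>Scalar multiples of finitely supported functions\<close>

lemma lookup_pscale [simp]: "Poly_Mapping.lookup (c \<cdot> x) k = c * Poly_Mapping.lookup x k"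
  by (simp add: pscale_def Poly_Mapping.map.rep_eq when_def)

lemma pscale_alt: "c \<cdot> (x :: 'k::monoid_add \<Rightarrow>\<^sub>0 complex) = Poly_Mapping.single 0 c * x"
  by (simp add: pscale_def mult_map_scale_conv_mult)

lemma pscale_add: "c \<cdot> (x + y) = c \<cdot> x + c \<cdot> y"
  by (rule poly_mapping_eqI) (simp add: lookup_add algebra_simps)

lemma pscale_zero [simp]: "c \<cdot> 0 = 0" "0 \<cdot> x = 0"
  by (rule poly_mapping_eqI, simp)+

lemma pscale_one [simp]: "1 \<cdot> x = x"
  by (rule poly_mapping_eqI) simp

lemma pscale_pscale [simp]: "b \<cdot> c \<cdot> x = (b * c) \<cdot> x"
  by (rule poly_mapping_eqI) simp

lemma pscale_minus_one: "(- 1) \<cdot> x = - x"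
  by (rule poly_mapping_eqI) simp

lemma pscale_single [simp]: "c \<cdot> Poly_Mapping.single k a = Poly_Mapping.single k (c * a)"
  by (simp add: pscale_def)

lemma keys_pscale: "Poly_Mapping.keys (c \<cdot> x) \<subseteq> Poly_Mapping.keys x"
  by (auto simp: in_keys_iff)

lemma pscale_mult_left: "(c \<cdot> x) * y = c \<cdot> (x * (y :: 'k::monoid_add \<Rightarrow>\<^sub>0 complex))"
  by (simp add: pscale_alt mult.assoc)

lemma poly_mapping_sum_single:
  "x = (\<Sum>k\<in>Poly_Mapping.keys x. Poly_Mapping.single k (Poly_Mapping.lookup x k))"
  by (rule poly_mapping_eqI)
    (simp add: lookup_sum lookup_single when_def sum.delta' in_keys_iff)

section \<open>Presented algebras\<close>

lemma alg_hom_memE: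
  assumes "f \<in> alg_hom A B"
  shows "x \<in> carrier A \<Longrightarrow> f x \<in> carrier B"
    and "x \<in> carrier A \<Longrightarrow> y \<in> carrier A \<Longrightarrow> f (x \<otimes>\<^bsub>A\<^esub> y) = f x \<otimes>\<^bsub>B\<^esub> f y"
    and "x \<in> carrier A \<Longrightarrow> y \<in> carrier A \<Longrightarrow> f (x \<oplus>\<^bsub>A\<^esub> y) = f x \<oplus>\<^bsub>B\<^esub> f y"
    and "f \<one>\<^bsub>A\<^esub> = \<one>\<^bsub>B\<^esub>"
    and "x \<in> carrier A \<Longrightarrow> f (c \<odot>\<^bsub>A\<^esub> x) = c \<odot>\<^bsub>B\<^esub> f x"
  using assms unfolding alg_hom_def ring_hom_def by auto

lemma alg_hom_comp:
  assumes "f \<in> alg_hom A B" "g \<in> alg_hom B C"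
  shows "g \<circ> f \<in> alg_hom A C"
  using assms unfolding alg_hom_def ring_hom_def by (auto simp: Pi_iff)

lemma carrier_free_alg_iff:
  "x \<in> carrier (free_alg S) \<longleftrightarrow> (\<forall>w\<in>Poly_Mapping.keys x. set (letters w) \<subseteq> S)"
  by (simp add: free_alg_def)

lemma carrier_free_alg_UNIV [simp]: "carrier (free_alg UNIV) = UNIV"
  by (auto simp: carrier_free_alg_iff)

lemma free_alg_simps [simp]:
  "x \<otimes>\<^bsub>free_alg S\<^esub> y = x * y" "x \<oplus>\<^bsub>free_alg S\<^esub> y = x + y" "\<one>\<^bsub>free_alg S\<^esub> = 1" "\<zero>\<^bsub>free_alg S\<^esub> = 0"
  "c \<odot>\<^bsub>free_alg S\<^esub> x = c \<cdot> x"
  by (simp_all add: free_alg_def)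

lemma free_alg_closed:
  "0 \<in> carrier (free_alg S)"
  "1 \<in> carrier (free_alg S)"
  "x \<in> carrier (free_alg S) \<Longrightarrow> y \<in> carrier (free_alg S) \<Longrightarrow> x + y \<in> carrier (free_alg S)"
  "x \<in> carrier (free_alg S) \<Longrightarrow> y \<in> carrier (free_alg S) \<Longrightarrow> x * y \<in> carrier (free_alg S)"
  "x \<in> carrier (free_alg S) \<Longrightarrow> c \<cdot> x \<in> carrier (free_alg S)"
  "x \<in> carrier (free_alg S) \<Longrightarrow> - x \<in> carrier (free_alg S)"
  "g \<in> S \<Longrightarrow> gen g \<in> carrier (free_alg S)"
proof -
  assume x: "x \<in> carrier (free_alg S)"
  then show "c \<cdot> x \<in> carrier (free_alg S)" for c
    using keys_pscale[of c x] by (auto simp: carrier_free_alg_iff)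
  from this[of "- 1"] show "- x \<in> carrier (free_alg S)" by (simp add: pscale_minus_one)
  assume y: "y \<in> carrier (free_alg S)"
  from x y show "x + y \<in> carrier (free_alg S)"
    using keys_add[of x y] by (auto simp: carrier_free_alg_iff)
  from x y show "x * y \<in> carrier (free_alg S)"
    using keys_mult[of x y] by (fastforce simp: carrier_free_alg_iff plus_fmon_def)
qed (auto simp: carrier_free_alg_iff zero_fmon_def gen_def)

lemma free_alg_diff_closed:
  "x \<in> carrier (free_alg S) \<Longrightarrow> y \<in> carrier (free_alg S) \<Longrightarrow> x - y \<in> carrier (free_alg S)"
  using free_alg_closed(3)[of x S "- y"] free_alg_closed(6)[of y S] by simp

lemma ring_free_alg: "ring (free_alg S)"
proof (rule ringI)
  show "abelian_group (free_alg S)"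
  proof (rule abelian_groupI)
    fix x assume "x \<in> carrier (free_alg S)"
    then show "\<exists>y\<in>carrier (free_alg S). y \<oplus>\<^bsub>free_alg S\<^esub> x = \<zero>\<^bsub>free_alg S\<^esub>"
      by (intro bexI[of _ "- x"]) (auto intro: free_alg_closed)
  qed (auto intro: free_alg_closed simp: algebra_simps)
  show "Group.monoid (free_alg S)"
    by (rule monoidI) (auto intro: free_alg_closed simp: algebra_simps)
qed (auto simp: algebra_simps)

lemma free_alg_single_induct [consumes 1, case_names zero single add]:
  assumes x: "x \<in> carrier (free_alg S)"
    and "P 0" and single: "\<And>w c. w \<in> Poly_Mapping.keys x \<Longrightarrow> set (letters w) \<subseteq> S \<Longrightarrow> P (Poly_Mapping.single w c)"
    and add: "\<And>y z. y \<in> carrier (free_alg S) \<Longrightarrow> z \<in> carrier (free_alg S) \<Longrightarrow> P y \<Longrightarrow> P z \<Longrightarrow> P (y + z)"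
  shows "P x"
proof -
  have "finite B \<Longrightarrow> B \<subseteq> Poly_Mapping.keys x \<Longrightarrow>
      (\<Sum>k\<in>B. Poly_Mapping.single k (Poly_Mapping.lookup x k)) \<in> carrier (free_alg S)
      \<and> P (\<Sum>k\<in>B. Poly_Mapping.single k (Poly_Mapping.lookup x k))" for B
  proof (induction B rule: finite_induct)
    case empty
    then show ?case using \<open>P 0\<close> by (simp add: free_alg_closed)
  next
    case (insert w B)
    have w: "set (letters w) \<subseteq> S" using insert.prems x by (auto simp: carrier_free_alg_iff)
    then have "Poly_Mapping.single w (Poly_Mapping.lookup x w) \<in> carrier (free_alg S)"
      by (auto simp: carrier_free_alg_iff)
    with insert w single[of w] add show ?case by (auto intro: free_alg_closed)
  qed
  from this[of "Poly_Mapping.keys x"] show ?thesis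
    using poly_mapping_sum_single[of x] by simp
qed

lemma single_Nil: "Poly_Mapping.single (FMon []) c = c \<cdot> 1"
  by (simp add: pscale_alt flip: zero_fmon_def)

lemma single_Cons: "Poly_Mapping.single (FMon (g # w)) c = gen g * Poly_Mapping.single (FMon w) c"
  by (simp add: gen_def mult_single plus_fmon_def)

lemma free_alg_induct [consumes 1, case_names one gen mult add scale]:
  assumes x: "x \<in> carrier (free_alg S)"
    and one: "P 1" and gen: "\<And>g. g \<in> S \<Longrightarrow> P (gen g)"
    and mult: "\<And>y z. y \<in> carrier (free_alg S) \<Longrightarrow> z \<in> carrier (free_alg S) \<Longrightarrow> P y \<Longrightarrow> P z \<Longrightarrow> P (y * z)"
    and add: "\<And>y z. y \<in> carrier (free_alg S) \<Longrightarrow> z \<in> carrier (free_alg S) \<Longrightarrow> P y \<Longrightarrow> P z \<Longrightarrow> P (y + z)"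
    and scale: "\<And>c y. y \<in> carrier (free_alg S) \<Longrightarrow> P y \<Longrightarrow> P (c \<cdot> y)"
  shows "P x"
  using x
proof (induction rule: free_alg_single_induct)
  case zero
  \<comment> \<open>Zero enters as 0 times the unit.\<close>
  show ?case using scale[of 1 0] one by (simp add: free_alg_closed)
next
  case (single w c)
  have "set u \<subseteq> S \<Longrightarrow> Poly_Mapping.single (FMon u) 1 \<in> carrier (free_alg S) \<and> P (Poly_Mapping.single (FMon u) 1)" for u
  proof (induction u)
    case Nil
    show ?case using one by (simp add: free_alg_closed single_Nil)
  next
    case (Cons g u)
    then show ?case unfolding single_Cons by (auto intro!: free_alg_closed mult gen)
  qed
  from this[of "letters w"] single have
    "Poly_Mapping.single w 1 \<in> carrier (free_alg S)" "P (Poly_Mapping.single w 1)" by simp_all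
  from scale[OF this, of c] show ?case by simp
next
  case (add y z)
  then show ?case by (rule assms(5))
qed

text \<open>Both maps turn an operation into the same expression in the operations of
  \<open>B\<close>, so agreement on letters propagates by \<open>free_alg_induct\<close>. Since
  \<open>B\<close> is a bare record, the result also covers targets such as
  \<open>EndV\<close>.\<close>

lemma free_alg_hom_eqI:
  assumes f: "f \<in> alg_hom (free_alg S) B" and g: "g \<in> alg_hom (free_alg S) B"
    and "\<And>s. s \<in> S \<Longrightarrow> f (gen s) = g (gen s)" and "x \<in> carrier (free_alg S)"
  shows "f x = g x"
  using assms(4)
proof (induction rule: free_alg_induct)
  case one
  show ?case using alg_hom_memE(4)[OF f] alg_hom_memE(4)[OF g] by simp
next
  case (gen s)
  then show ?case by (rule assms(3))
next
  case (mult y z)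
  then show ?case using alg_hom_memE(2)[OF f, of y z] alg_hom_memE(2)[OF g, of y z] by simp
next
  case (add y z)
  then show ?case using alg_hom_memE(3)[OF f, of y z] alg_hom_memE(3)[OF g, of y z] by simp
next
  case (scale c y)
  then show ?case using alg_hom_memE(5)[OF f, of y c] alg_hom_memE(5)[OF g, of y c] by simp
qed

lemma ideal_genideal_free_alg:
  "R \<subseteq> carrier (free_alg S) \<Longrightarrow> ideal (genideal (free_alg S) R) (free_alg S)"
  by (rule ring.genideal_ideal[OF ring_free_alg])

lemma pres_alg_simps:
  "carrier (pres_alg S R) = pres_cls S R ` carrier (free_alg S)"
  "monoid.mult (pres_alg S R) = monoid.mult (free_alg S Quot genideal (free_alg S) R)"
  "one (pres_alg S R) = one (free_alg S Quot genideal (free_alg S) R)"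
  "add (pres_alg S R) = add (free_alg S Quot genideal (free_alg S) R)"
  "zero (pres_alg S R) = zero (free_alg S Quot genideal (free_alg S) R)"
  by (auto simp: pres_alg_def quot_alg_def pres_cls_def FactRing_def A_RCOSETS_defs a_r_coset_def)

lemma pres_cls_hom:
  assumes "R \<subseteq> carrier (free_alg S)"
  shows "pres_cls S R \<in> alg_hom (free_alg S) (pres_alg S R)"
proof -
  interpret ideal "genideal (free_alg S) R" "free_alg S"
    by (rule ideal_genideal_free_alg) fact
  let ?I = "genideal (free_alg S) R"
  have "pres_cls S R \<in> ring_hom (free_alg S) (pres_alg S R)"
    using rcos_ring_hom unfolding ring_hom_def pres_alg_simps
    by (auto simp: pres_cls_def [abs_def])
  moreover have "pres_cls S R (c \<cdot> x) = c \<odot>\<^bsub>pres_alg S R\<^esub> pres_cls S R x"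
    if x: "x \<in> carrier (free_alg S)" for c x
  proof -
    \<comment> \<open>A scalar multiple in \<open>quot_alg\<close> is a union of cosets over all
      representatives of a class. A scalar acts as multiplication by the constant
      \<open>single 0 c\<close>, so the ideal absorbs it and all these cosets coincide.\<close>
    have eq: "?I +>\<^bsub>free_alg S\<^esub> (c \<cdot> y) = pres_cls S R (c \<cdot> x)" if y: "y \<in> pres_cls S R x" for y
    proof -
      from y obtain u where u: "u \<in> ?I" "y = u + x"
        unfolding pres_cls_def a_r_coset_def' by auto
      have "Poly_Mapping.single 0 c * u \<in> ?I"
        using I_l_closed[OF u(1), of "Poly_Mapping.single 0 c"]
        by (auto simp: carrier_free_alg_iff zero_fmon_def)
      then have "c \<cdot> u \<in> ?I" by (simp add: pscale_alt)
      moreover have "c \<cdot> u \<in> carrier (free_alg S)" "c \<cdot> x \<in> carrier (free_alg S)"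
        using calculation a_subset x by (auto intro: free_alg_closed)
      moreover have "c \<cdot> y = c \<cdot> u \<oplus>\<^bsub>free_alg S\<^esub> c \<cdot> x"
        using u(2) by (simp add: pscale_add)
      ultimately show ?thesis
        unfolding pres_cls_def
        by (metis a_coset_add_assoc a_rcos_zero a_subset is_ideal local.ring_axioms)
    qed
    have "x \<in> pres_cls S R x"
      using x unfolding pres_cls_def by (rule a_rcos_self)
    with eq show ?thesis
      by (auto simp: pres_alg_def quot_alg_def)
  qed
  ultimately show ?thesis
    by (simp add: alg_hom_def)
qed

lemma ring_pres_alg:
  assumes "R \<subseteq> carrier (free_alg S)"
  shows "ring (pres_alg S R)"
proof -
  interpret ideal "genideal (free_alg S) R" "free_alg S"
    by (rule ideal_genideal_free_alg) fact
  let ?Q = "free_alg S Quot genideal (free_alg S) R"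
  interpret Q: ring ?Q by (rule quotient_is_ring)
  have c: "carrier (pres_alg S R) = carrier ?Q" by (simp add: pres_alg_def quot_alg_def)
  note simps = c pres_alg_simps(2-)
  show ?thesis
  proof (rule ringI)
    show "abelian_group (pres_alg S R)"
      by (rule abelian_groupI)
        (simp_all add: simps Q.a_ac Q.add.l_inv_ex)
    show "Group.monoid (pres_alg S R)"
      by (rule monoidI) (auto simp: simps Q.m_assoc)
  qed (auto simp: simps Q.l_distr Q.r_distr)
qed

lemma pres_alg_smult_closed:
  assumes "R \<subseteq> carrier (free_alg S)" "x \<in> carrier (pres_alg S R)"
  shows "c \<odot>\<^bsub>pres_alg S R\<^esub> x \<in> carrier (pres_alg S R)"
proof -
  note h = pres_cls_hom[OF assms(1)]
  from assms(2) obtain y where y: "y \<in> carrier (free_alg S)" "x = pres_cls S R y"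
    by (auto simp: pres_alg_simps)
  then show ?thesis
    using alg_hom_memE(5)[OF h y(1), of c] alg_hom_memE(1)[OF h free_alg_closed(5)[OF y(1)], of c]
    by simp
qed

lemma pres_cls_eqI:
  assumes "R \<subseteq> carrier (free_alg S)" "x \<in> carrier (free_alg S)" "y \<in> carrier (free_alg S)"
    and "x - y \<in> R"
  shows "pres_cls S R x = pres_cls S R y"
proof -
  interpret ideal "genideal (free_alg S) R" "free_alg S"
    by (rule ideal_genideal_free_alg) fact
  have "x - y \<in> genideal (free_alg S) R"
    using genideal_self[OF assms(1)] assms(4) by blast
  then have "x \<in> genideal (free_alg S) R +>\<^bsub>free_alg S\<^esub> y"
    unfolding a_r_coset_def' by (force intro: bexI[of _ "x - y"])
  from a_repr_independence[OF this assms(3) a_subgroup] show ?thesis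
    by (simp add: pres_cls_def)
qed

lemma pres_alg_hom_eqI:
  assumes R: "R \<subseteq> carrier (free_alg S)"
    and f: "f \<in> alg_hom (pres_alg S R) B" and g: "g \<in> alg_hom (pres_alg S R) B"
    and "\<And>s. s \<in> S \<Longrightarrow> f (pres_cls S R (gen s)) = g (pres_cls S R (gen s))"
    and "x \<in> carrier (pres_alg S R)"
  shows "f x = g x"
proof -
  from assms(5) obtain y where y: "y \<in> carrier (free_alg S)" "x = pres_cls S R y"
    by (auto simp: pres_alg_simps)
  note h = alg_hom_comp[OF pres_cls_hom[OF R]]
  from free_alg_hom_eqI[OF h[OF f] h[OF g] _ y(1)] assms(4) show ?thesis
    by (simp add: y(2))
qed

section \<open>Filtrations of free algebras\<close>

text \<open>The instance in view is the family of preimages of \<open>FV A k\<close> under a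
  morphism from the free algebra. Working upstairs makes the defining relations available as
  explicit elements.\<close>

locale falg_filtration =
  fixes W :: "int \<Rightarrow> 'g falg set"
  assumes zero: "0 \<in> W k"
    and add: "x \<in> W k \<Longrightarrow> y \<in> W k \<Longrightarrow> x + y \<in> W k"
    and scale: "x \<in> W k \<Longrightarrow> c \<cdot> x \<in> W k"
    and mult: "x \<in> W j \<Longrightarrow> y \<in> W k \<Longrightarrow> x * y \<in> W (j + k)"
    and one: "1 \<in> W 0"
    and mono: "j \<le> k \<Longrightarrow> W j \<subseteq> W k"
begin

lemma uminus: "x \<in> W k \<Longrightarrow> - x \<in> W k"
  using scale[of x k "- 1"] by (simp add: pscale_minus_one)

lemma diff: "x \<in> W k \<Longrightarrow> y \<in> W k \<Longrightarrow> x - y \<in> W k"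
  using add[OF _ uminus, of x k y] by simp

lemma diff_cancel: "x - y \<in> W k \<Longrightarrow> x \<in> W k \<Longrightarrow> y \<in> W k"
  using diff[of x k "x - y"] by simp

lemma sum: "(\<And>a. a \<in> B \<Longrightarrow> f a \<in> W k) \<Longrightarrow> sum f B \<in> W k"
  by (induction B rule: infinite_finite_induct) (auto intro: zero add)

lemma Sum_any: "(\<And>a. f a \<in> W k) \<Longrightarrow> Sum_any f \<in> W k"
  \<comment> \<open>With infinite support the sum is 0 by default, and 0 lies in \<open>W k\<close>
    as well.\<close>
  unfolding Sum_any.expand_set by (rule sum)

lemma power: "x \<in> W 0 \<Longrightarrow> x ^ n \<in> W 0"
  by (induction n) (auto intro: one mult[of _ 0 _ 0, simplified])

lemma pw: "a \<in> W 0 \<Longrightarrow> pw a r q \<in> W 0"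
  by (auto simp: pw_def intro: zero scale power)

lemma comm: "x \<in> W j \<Longrightarrow> y \<in> W k \<Longrightarrow> comm x y \<in> W (j + k)"
  using mult[of x j y k] mult[of y k x j] by (auto simp: comm_def add.commute intro: diff)

lemma single:
  assumes gens: "\<And>g. g \<in> set (letters w) \<Longrightarrow> gen g \<in> W (dg g)" and "(\<Sum>g\<leftarrow>letters w. dg g) \<le> k"
  shows "Poly_Mapping.single w c \<in> W k"
proof -
  have "(\<And>g. g \<in> set u \<Longrightarrow> gen g \<in> W (dg g)) \<Longrightarrow> Poly_Mapping.single (FMon u) c \<in> W (\<Sum>g\<leftarrow>u. dg g)" for u
  proof (induction u)
    case Nil
    show ?case by (simp add: one scale single_Nil)
  next
    case (Cons g u)
    then show ?case unfolding single_Cons by (auto intro: mult)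
  qed
  from this[of "letters w"] gens mono[OF assms(2)] show ?thesis by auto
qed

lemma bounded_degree:
  assumes "\<And>g. gen g \<in> W (dg g)" and "\<forall>w\<in>Poly_Mapping.keys x. (\<Sum>g\<leftarrow>letters w. dg g) \<le> k"
  shows "x \<in> W k"
proof -
  have "(\<Sum>w\<in>Poly_Mapping.keys x. Poly_Mapping.single w (Poly_Mapping.lookup x w)) \<in> W k"
    using assms by (intro sum single) auto
  then show ?thesis using poly_mapping_sum_single[of x] by simp
qed

end

section \<open>Degrees of the generators h and of the images of the Yangian generators\<close>

lemma gen_GH_in_filtration:
  assumes "falg_filtration W" and R: "\<And>k. dy_rels A \<subseteq> W k"
    and gx: "\<And>s r. gen (GX s i r) \<in> W r" and gc: "gen GC \<in> W 0"
  shows "gen (GH i r) \<in> W r"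
proof -
  interpret falg_filtration W by fact
  define sh where "sh = shift ((1 / 2) \<cdot> cc) (hp i)"
  \<comment> \<open>The coefficient of \<open>z\<^bsup>-1\<^esup>\<close> of the relation for \<open>[x\<^sub>i\<^sup>+(z), x\<^sub>i\<^sup>-(w)]\<close> is \<open>[x\<^sub>i\<^sub>0\<^sup>+, x\<^sub>i\<^sup>-(w)] = h\<^sub>i\<^sup>+(w + c/2) + h\<^sub>i\<^sup>-(w)\<close>.\<close>
  have key: "sh q + hm i q \<in> W (- q - 1)" for q
  proof -
    have pw0: "pw cc 0 k = (if k = 0 then 1 else 0)" for k :: int
      by (auto simp: pw_def gbinomial_0_left)
    have "(\<lambda>k. pw cc 0 k * shift ((1 / 2) \<cdot> cc) (hp i) (q - k)) = (\<lambda>k. if k = 0 then sh (q - k) else 0)"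
      by (auto simp: pw0 sh_def)
    then have s1: "Sum_any (\<lambda>k. pw cc 0 k * shift ((1 / 2) \<cdot> cc) (hp i) (q - k)) = sh q"
      by (simp only: Sum_any.delta) simp
    have "(\<lambda>k. delta k q * hm i (-1 - k)) = (\<lambda>k. if k = -1 - q then hm i (-1 - k) else 0)"
      by (auto simp: delta_def)
    then have s2: "Sum_any (\<lambda>k. delta k q * hm i (-1 - k)) = hm i q"
      by (simp only: Sum_any.delta) simp
    \<comment> \<open>At z^(-1) the power (w + c)^0 is 1, so both delta functions have the same
      coefficient there and cancel.\<close>
    have d: "pw cc 0 q - delta (-1) q = 0"
      by (simp add: pw0 delta_def)
    have "comm (xf Pl i (-1)) (xf Mi i q) - (sh q + hm i q) \<in> dy_rels A"
      using dy_rels.xx_mixed[of i "-1" i q A] s1 s2 by (simp add: d)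
    \<comment> \<open>Relations lie in every \<open>W k\<close>, so this one may be placed in the
      step of the commutator.\<close>
    then have "comm (xf Pl i (-1)) (xf Mi i q) - (sh q + hm i q) \<in> W (- q - 1)"
      using R by blast
    moreover have "comm (xf Pl i (-1)) (xf Mi i q) \<in> W (- q - 1)"
      using comm[OF gx gx, of Pl 0 Mi "- q - 1"] by (simp add: xf_def)
    ultimately show ?thesis
      by (rule diff_cancel)
  qed
  have supp: "hp i n * pw ((1 / 2) \<cdot> cc) n q \<noteq> 0 \<Longrightarrow> q \<le> n \<and> n \<le> -1" for n q
    by (auto simp: hp_def pw_def split: if_splits)
  show ?thesis
  proof (cases "r < 0")
    case True
    let ?q = "- r - 1"
    \<comment> \<open>For r < 0 the exponent \<open>?q\<close> is nonnegative, while the shifted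
      plus series has only negative powers; hence \<open>key\<close> is left with the minus series
      alone.\<close>
    have "hp i n * pw ((1 / 2) \<cdot> cc) n ?q = 0" for n
      using supp[of n ?q] True by fastforce
    then have "sh ?q = 0"
      by (simp add: sh_def shift_def)
    then show ?thesis using key[of ?q] True by (simp add: hm_def)
  next
    case False
    then obtain n where "r = int n" by (metis nonneg_int_cases not_less)
    moreover have "gen (GH i (int n)) \<in> W (int n)"
    proof (induction n rule: less_induct)
      case (less n)
      define q where "q = - int n - 1"
      \<comment> \<open>The lowest exponent k = q contributes the generator of index n itself,
        because (w + c/2)^q starts with coefficient 1. Every larger k contributes a generator of
        smaller index times a multiple of a power of c, which has degree 0; these are covered by the
        induction hypothesis.\<close>
      have "sh q = (\<Sum>k\<in>{q..-1}. hp i k * pw ((1 / 2) \<cdot> cc) k q)"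
        unfolding sh_def shift_def using supp by (intro Sum_any.expand_superset) auto
      also have "{q..-1} = insert q {q<..-1}" by (auto simp: q_def)
      also have "(\<Sum>k\<in>insert q {q<..-1}. hp i k * pw ((1 / 2) \<cdot> cc) k q) =
          gen (GH i (int n)) + (\<Sum>k\<in>{q<..-1}. hp i k * pw ((1 / 2) \<cdot> cc) k q)"
        by (subst sum.insert) (auto simp: hp_def pw_def q_def)
      finally have eq: "sh q = \<dots>" .
      have "(\<Sum>k\<in>{q<..-1}. hp i k * pw ((1 / 2) \<cdot> cc) k q) \<in> W (int n)"
      proof (rule sum)
        fix k assume k: "k \<in> {q<..-1}"
        then have "gen (GH i (int (nat (- k - 1)))) \<in> W (int (nat (- k - 1)))"
          by (intro less.IH) (auto simp: q_def)
        then have "hp i k \<in> W (- k - 1)" using k by (simp add: hp_def)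
        moreover have "pw ((1 / 2) \<cdot> cc) k q \<in> W 0"
          using gc by (intro pw scale) (simp add: cc_def)
        ultimately have "hp i k * pw ((1 / 2) \<cdot> cc) k q \<in> W (- k - 1)"
          using mult by fastforce
        then show "hp i k * pw ((1 / 2) \<cdot> cc) k q \<in> W (int n)"
          using mono[of "- k - 1" "int n"] k by (auto simp: q_def)
      qed
      moreover have "sh q \<in> W (int n)"
        using key[of q] by (simp add: hm_def q_def)
      ultimately show ?case using eq diff by fastforce
    qed
    ultimately show ?thesis by simp
  qed
qed

text \<open>Shifting by a multiple of c raises no degree: the coefficient of z^(-r-1) involves x
  only with indices up to r, multiplied by powers of c.\<close>

lemma iota_x_in_filtration:
  assumes "falg_filtration W" and gx: "\<And>s r. gen (GX s i r) \<in> W r" and gc: "gen GC \<in> W 0"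
  shows "iota_x s i r \<in> W (int r)"
proof -
  interpret falg_filtration W by fact
  show ?thesis
    unfolding iota_x_def shift_def
  proof (rule Sum_any)
    fix n
    have p: "pw ((sg s / 2) \<cdot> cc) n (- int r - 1) \<in> W 0"
      using gc by (intro pw scale) (simp add: cc_def)
    show "bx s i n * pw ((sg s / 2) \<cdot> cc) n (- int r - 1) \<in> W (int r)"
    proof (cases "- int r - 1 \<le> n")
      case True
      have "bx s i n \<in> W (- n - 1)"
        using gx by (auto simp: bx_def zero)
      from mult[OF this p] have "bx s i n * pw ((sg s / 2) \<cdot> cc) n (- int r - 1) \<in> W (- n - 1)" by simp
      then show ?thesis using mono[of "- n - 1" "int r"] True by auto
    next
      case False
      then show ?thesis by (simp add: pw_def zero)
    qed
  qed
qed

section \<open>Operators on the space\<close>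

lemma lookup_vscale [simp]: "Poly_Mapping.lookup (vscale c v) \<beta> = c \<cdot> Poly_Mapping.lookup v \<beta>"
  by (simp add: vscale_def Poly_Mapping.map.rep_eq when_def)

lemma vsp_eqI:
  fixes v w :: "'i vsp"
  assumes "\<And>\<beta> m. Poly_Mapping.lookup (Poly_Mapping.lookup v \<beta>) m = Poly_Mapping.lookup (Poly_Mapping.lookup w \<beta>) m"
  shows "v = w"
  using assms by (intro poly_mapping_eqI)

interpretation V: vector_space "vscale :: complex \<Rightarrow> 'i vsp \<Rightarrow> 'i vsp"
  by unfold_locales (rule vsp_eqI; simp add: lookup_add algebra_simps)+

lemma vlinear_iff:
  "vlinear T \<longleftrightarrow> (\<forall>v w. T (v + w) = T v + T w) \<and> (\<forall>c v. T (vscale c v) = vscale c (T v))"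
  unfolding vlinear_def Vector_Spaces.linear_def module_hom_iff
  by (auto simp: V.vector_space_axioms V.module_axioms)

lemma vlinear_zero: "vlinear T \<Longrightarrow> T 0 = 0"
  using V.scale_zero_left by (metis vlinear_iff)

lemma vlinear_sum: "vlinear T \<Longrightarrow> T (\<Sum>a\<in>B. f a) = (\<Sum>a\<in>B. T (f a))"
  by (induction B rule: infinite_finite_induct) (auto simp: vlinear_zero vlinear_iff)

lemma vlinear_comp: "vlinear S \<Longrightarrow> vlinear T \<Longrightarrow> vlinear (\<lambda>v. S (T v))"
  by (simp add: vlinear_iff)

lemma vlinear_sumI:
  assumes "\<And>a. a \<in> B \<Longrightarrow> vlinear (T a)"
  shows "vlinear (\<lambda>v. \<Sum>a\<in>B. T a v)"
  using assms by (auto simp: vlinear_iff sum.distrib V.scale_sum_right intro!: sum.cong)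

lemma Vgr_closed:
  "0 \<in> Vgr A n" "v \<in> Vgr A n \<Longrightarrow> w \<in> Vgr A n \<Longrightarrow> v + w \<in> Vgr A n"
  "v \<in> Vgr A n \<Longrightarrow> vscale c v \<in> Vgr A n"
  "(\<And>a. a \<in> B \<Longrightarrow> f a \<in> Vgr A n) \<Longrightarrow> sum f B \<in> Vgr A n"
proof -
  show 0: "0 \<in> Vgr A n" by (simp add: Vgr_def)
  have plus: "v + w \<in> Vgr A n" if "v \<in> Vgr A n" "w \<in> Vgr A n" for v w
    using that unfolding Vgr_def by (auto simp: lookup_add dest!: subsetD[OF keys_add])
  then show "v \<in> Vgr A n \<Longrightarrow> w \<in> Vgr A n \<Longrightarrow> v + w \<in> Vgr A n" .
  show "v \<in> Vgr A n \<Longrightarrow> vscale c v \<in> Vgr A n"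
    unfolding Vgr_def by (auto dest!: subsetD[OF keys_pscale])
  show "sum f B \<in> Vgr A n" if "\<And>a. a \<in> B \<Longrightarrow> f a \<in> Vgr A n"
    using that by (induction B rule: infinite_finite_induct) (auto intro: plus 0)
qed

lemma Endm_vlinear: "T \<in> Endm A m \<Longrightarrow> vlinear T"
  by (simp add: Endm_def)

lemma Endm_closed:
  "(\<lambda>v. 0) \<in> Endm A m" "id \<in> Endm A 0"
  "S \<in> Endm A m \<Longrightarrow> T \<in> Endm A m \<Longrightarrow> (\<lambda>v. S v + T v) \<in> Endm A m"
  "T \<in> Endm A m \<Longrightarrow> (\<lambda>v. vscale c (T v)) \<in> Endm A m"
  by (auto simp: Endm_def vlinear_iff image_subset_iff V.scale_right_distrib Vgr_closed mult.commute
      algebra_simps)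

lemma Endm_comp: "S \<in> Endm A j \<Longrightarrow> T \<in> Endm A k \<Longrightarrow> (\<lambda>v. S (T v)) \<in> Endm A (j + k)"
  by (fastforce simp: Endm_def vlinear_comp image_subset_iff ac_simps)

lemma Endm_sum:
  assumes "\<And>a. a \<in> B \<Longrightarrow> T a \<in> Endm A m"
  shows "(\<lambda>v. \<Sum>a\<in>B. T a v) \<in> Endm A m"
  using assms by (auto simp: Endm_def image_subset_iff intro!: vlinear_sumI Vgr_closed(4))

section \<open>The completed endomorphism algebra and its filtration\<close>

lemma tEnd_simps [simp]:
  "(S \<oplus>\<^bsub>tEnd A\<^esub> T) m v = S m v + T m v"
  "(c \<odot>\<^bsub>tEnd A\<^esub> T) m v = vscale c (T m v)"
  "\<one>\<^bsub>tEnd A\<^esub> = (\<lambda>m. if m = 0 then id else (\<lambda>v. 0))"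
  "\<zero>\<^bsub>tEnd A\<^esub> = (\<lambda>m v. 0)"
  by (simp_all add: tEnd_def)

lemma FV_iff: "T \<in> FV A k \<longleftrightarrow> (\<forall>m. T m \<in> Endm A m) \<and> (\<forall>m>k. T m = (\<lambda>v. 0))"
  by (auto simp: FV_def tEnd_def)

lemma FV_mono: "j \<le> k \<Longrightarrow> FV A j \<subseteq> FV A k"
  by (auto simp: FV_iff)

lemma FV_zero: "(\<lambda>m v. 0) \<in> FV A k"
  by (simp add: FV_iff Endm_closed)

lemma FV_one: "\<one>\<^bsub>tEnd A\<^esub> \<in> FV A 0"
  by (simp add: FV_iff Endm_closed)

lemma tEnd_add_alt: "S \<oplus>\<^bsub>tEnd A\<^esub> T = (\<lambda>m v. S m v + T m v)"
  by (simp add: fun_eq_iff)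

lemma tEnd_smult_alt: "c \<odot>\<^bsub>tEnd A\<^esub> T = (\<lambda>m v. vscale c (T m v))"
  by (simp add: fun_eq_iff)

lemma FV_add: "S \<in> FV A k \<Longrightarrow> T \<in> FV A k \<Longrightarrow> S \<oplus>\<^bsub>tEnd A\<^esub> T \<in> FV A k"
  by (auto simp: FV_iff tEnd_add_alt Endm_closed)

lemma FV_scale: "T \<in> FV A k \<Longrightarrow> c \<odot>\<^bsub>tEnd A\<^esub> T \<in> FV A k"
  by (auto simp: FV_iff tEnd_smult_alt Endm_closed)

lemma tEnd_mult:
  "(S \<otimes>\<^bsub>tEnd A\<^esub> T) m = (\<lambda>v. \<Sum>k | S k \<noteq> (\<lambda>v. 0) \<and> T (m - k) \<noteq> (\<lambda>v. 0). S k (T (m - k) v))"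
  by (simp add: tEnd_def)

text \<open>A summand of component m pairs degree i of S with degree m - i of T. If m > j + k, one
  of the two exceeds its bound; if m = j + k, the only pair within both bounds is (j, k). Top
  components therefore multiply, which is what makes symbols multiplicative.\<close>

lemma FV_mult:
  assumes S: "S \<in> FV A j" and T: "T \<in> FV A k"
  shows "S \<otimes>\<^bsub>tEnd A\<^esub> T \<in> FV A (j + k)"
    and "(S \<otimes>\<^bsub>tEnd A\<^esub> T) (j + k) v = S j (T k v)"
proof -
  have "(\<lambda>v. S i (T (m - i) v)) \<in> Endm A m" for i m
    using Endm_comp[of "S i" A i "T (m - i)" "m - i"] S T by (simp add: FV_iff)
  then have "(S \<otimes>\<^bsub>tEnd A\<^esub> T) m \<in> Endm A m" for m
    unfolding tEnd_mult by (rule Endm_sum)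
  moreover have "(S \<otimes>\<^bsub>tEnd A\<^esub> T) m = (\<lambda>v. 0)" if "m > j + k" for m
  proof -
    have "S i = (\<lambda>v. 0) \<or> T (m - i) = (\<lambda>v. 0)" for i
      using S T that by (cases "i > j") (auto simp: FV_iff)
    then show ?thesis unfolding tEnd_mult by (auto intro!: sum.neutral)
  qed
  ultimately show "S \<otimes>\<^bsub>tEnd A\<^esub> T \<in> FV A (j + k)" by (simp add: FV_iff)
  have "S i = (\<lambda>v. 0) \<or> T (j + k - i) = (\<lambda>v. 0)" if "i \<noteq> j" for i
    using S T that by (cases "i > j") (auto simp: FV_iff)
  \<comment> \<open>The index set of the product may also be empty, namely when S j or T k vanishes;
    the summand at j is then zero, by linearity of S j.\<close>
  then have "(S \<otimes>\<^bsub>tEnd A\<^esub> T) (j + k) v = (\<Sum>i\<in>{j}. S i (T (j + k - i) v))"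
    unfolding tEnd_mult using vlinear_zero[OF Endm_vlinear, of "S j" A j] S
    by (intro sum.mono_neutral_left) (auto simp: FV_iff)
  then show "(S \<otimes>\<^bsub>tEnd A\<^esub> T) (j + k) v = S j (T k v)" by simp
qed

lemma tEnd_filtration:
  assumes h: "h \<in> alg_hom (free_alg UNIV) (tEnd A)"
  shows "falg_filtration (\<lambda>k. {x. h x \<in> FV A k})"
proof
  have sc: "h (c \<cdot> x) = c \<odot>\<^bsub>tEnd A\<^esub> h x" for c x using alg_hom_memE(5)[OF h, of x c] by simp
  fix x y c and j k :: int
  show one: "1 \<in> {x. h x \<in> FV A 0}" using alg_hom_memE(4)[OF h] FV_one[of A] by simp
  \<comment> \<open>\<open>alg_hom\<close> speaks of sums, products, scalars and the unit; the value
    at 0 is found as 0 times the value at 1.\<close>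
  have "h 0 = 0 \<odot>\<^bsub>tEnd A\<^esub> h 1" using sc[of 0 1] by simp
  then have "h 0 = (\<lambda>m v. 0)" by (simp add: fun_eq_iff)
  then show "0 \<in> {x. h x \<in> FV A k}" by (simp add: FV_zero)
  show "x \<in> {x. h x \<in> FV A k} \<Longrightarrow> y \<in> {x. h x \<in> FV A k} \<Longrightarrow> x + y \<in> {x. h x \<in> FV A k}"
    using alg_hom_memE(3)[OF h, of x y] by (simp add: FV_add)
  show "x \<in> {x. h x \<in> FV A k} \<Longrightarrow> c \<cdot> x \<in> {x. h x \<in> FV A k}"
    by (simp add: sc FV_scale)
  show "x \<in> {x. h x \<in> FV A j} \<Longrightarrow> y \<in> {x. h x \<in> FV A k} \<Longrightarrow> x * y \<in> {x. h x \<in> FV A (j + k)}"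
    using alg_hom_memE(2)[OF h, of x y] by (simp add: FV_mult)
  show "j \<le> k \<Longrightarrow> {x. h x \<in> FV A j} \<subseteq> {x. h x \<in> FV A k}"
    using FV_mono by blast
qed

text \<open>The preimage of \<open>FV\<close> is multiplicative, so bounds on the letters give
  bounds on monomials and then on their combinations.\<close>

lemma filtered_hom_pres_algI:
  assumes f: "f \<in> alg_hom (pres_alg UNIV R) (tEnd A)"
    and gens: "\<And>g. f (pres_cls UNIV R (gen g)) \<in> FV A (dg g)"
  shows "filtered_hom (pres_alg UNIV R) (pres_filt UNIV R dg) (tEnd A) (FV A) f"
proof -
  have h: "f \<circ> pres_cls UNIV R \<in> alg_hom (free_alg UNIV) (tEnd A)"
    by (rule alg_hom_comp[OF pres_cls_hom f]) simp
  interpret falg_filtration "\<lambda>k. {x. (f \<circ> pres_cls UNIV R) x \<in> FV A k}"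
    by (rule tEnd_filtration[OF h])
  show ?thesis
    using f bounded_degree[of dg] gens by (auto simp: filtered_hom_def pres_filt_def)
qed

text \<open>A relation has the class of 0, and 0 goes into every step. This supplies the assumption
  on relations in \<open>gen_GH_in_filtration\<close>.\<close>

lemma pres_cls_rel:
  assumes "f \<in> alg_hom (pres_alg UNIV R) (tEnd A)" "u \<in> R"
  shows "f (pres_cls UNIV R u) \<in> FV A k"
proof -
  have "f \<circ> pres_cls UNIV R \<in> alg_hom (free_alg UNIV) (tEnd A)"
    by (rule alg_hom_comp[OF pres_cls_hom assms(1)]) simp
  then interpret falg_filtration "\<lambda>k. {x. (f \<circ> pres_cls UNIV R) x \<in> FV A k}"
    by (rule tEnd_filtration)
  have "pres_cls UNIV R u = pres_cls UNIV R 0"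
    using assms(2) by (intro pres_cls_eqI) auto
  then show ?thesis using zero[of k] by simp
qed

section \<open>The associated graded morphism\<close>

text \<open>The image of \<open>g\<close> under the graded morphism induced by \<open>f\<close> has the component \<open>S k\<close> in each
  degree \<open>k\<close>. All representatives of the cosets \<open>g k\<close> are constrained at once, which makes
  well-definedness of the operations of \<^const>\<open>gr_alg\<close> superfluous.\<close>

definition gr_symbol :: "('i::finite \<Rightarrow> 'i \<Rightarrow> int) \<Rightarrow> 'a calg \<Rightarrow> ('a \<Rightarrow> int \<Rightarrow> 'i vop) \<Rightarrow>
    (int \<Rightarrow> 'a set) \<Rightarrow> (int \<Rightarrow> 'i vop) \<Rightarrow> bool" where
  "gr_symbol A B f g S \<longleftrightarrow> finite {k. S k \<noteq> (\<lambda>v. 0)} \<and>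
     (\<forall>k. g k \<noteq> {} \<and> g k \<subseteq> carrier B \<and> (\<forall>x\<in>g k. f x \<in> FV A k \<and> f x k = S k))"

lemma gr_symbolD:
  assumes "gr_symbol A B f g S" "x \<in> g k"
  shows "x \<in> carrier B" "f x \<in> FV A k" "f x k = S k"
  using assms unfolding gr_symbol_def by blast+

lemma FV_lower:
  assumes "T \<in> FV A k" "T k = (\<lambda>v. 0)"
  shows "T \<in> FV A (k - 1)"
proof -
  have "T m = (\<lambda>v. 0)" if "m > k - 1" for m
    using assms that by (cases "m = k") (auto simp: FV_iff)
  with assms(1) show ?thesis by (simp add: FV_iff)
qed

text \<open>Modulo the step k - 1 exactly the component of degree k is remembered: elements of step
  k sharing it differ by one whose top component vanishes, and \<open>FV_lower\<close> moves that
  difference down a step.\<close>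

lemma FV_coset:
  assumes T: "T \<in> FV A k"
  shows "FV A (k - 1) +>\<^bsub>tEnd A\<^esub> T = {T' \<in> FV A k. T' k = T k}"
proof (intro equalityI subsetI)
  fix T' assume "T' \<in> FV A (k - 1) +>\<^bsub>tEnd A\<^esub> T"
  then obtain U where U: "U \<in> FV A (k - 1)" "T' = U \<oplus>\<^bsub>tEnd A\<^esub> T"
    by (auto simp: a_r_coset_def')
  then have "U \<in> FV A k" "U k = (\<lambda>v. 0)" using FV_mono[of "k - 1" k A] by (auto simp: FV_iff)
  with T show "T' \<in> {T' \<in> FV A k. T' k = T k}"
    unfolding U(2) by (simp add: FV_add fun_eq_iff)
next
  fix T' assume T': "T' \<in> {T' \<in> FV A k. T' k = T k}"
  let ?U = "T' \<oplus>\<^bsub>tEnd A\<^esub> ((- 1) \<odot>\<^bsub>tEnd A\<^esub> T)"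
  have "?U \<in> FV A k" using T T' by (auto intro!: FV_add FV_scale)
  moreover have "?U k = (\<lambda>v. 0)" using T' by (auto simp: fun_eq_iff)
  ultimately have "?U \<in> FV A (k - 1)" by (rule FV_lower)
  moreover have "T' = ?U \<oplus>\<^bsub>tEnd A\<^esub> T" by (simp add: fun_eq_iff)
  ultimately show "T' \<in> FV A (k - 1) +>\<^bsub>tEnd A\<^esub> T" by (auto simp: a_r_coset_def')
qed

text \<open>By \<open>FV_coset\<close> the image of \<open>g k\<close> is the single coset of
  elements with top component \<open>S k\<close>, and this coset is trivial precisely when
  \<open>S k\<close> is zero. So \<open>gr_to_End\<close> sums the symbol over its support.\<close>

lemma gr_rho_eq:
  assumes "gr_symbol A B f g S"
  shows "gr_rho A f g = (\<lambda>v. \<Sum>k | S k \<noteq> (\<lambda>v. 0). S k v)"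
proof
  fix v
  have eq: "gr_map (tEnd A) (FV A) f g k = {T \<in> FV A k. T k = S k}" (is "?G k = _") for k
    using assms unfolding gr_map_def gr_symbol_def by (auto simp: FV_coset)
  have ne: "?G k \<noteq> {}" for k
  proof -
    have "g k \<noteq> {}" "\<forall>x\<in>g k. f x \<in> FV A k \<and> f x k = S k"
      using assms by (auto simp: gr_symbol_def)
    then show ?thesis unfolding eq by blast
  qed
  \<comment> \<open>Nonemptiness makes this image a true singleton, so \<open>the_elem\<close> has
    its intended value.\<close>
  have "(\<lambda>T. T k) ` ?G k = {S k}" for k
    using ne[of k] by (auto simp: eq)
  then have comp: "the_elem ((\<lambda>T. T k) ` ?G k) = S k" for k by simp
  have "S k \<noteq> (\<lambda>v. 0)" if "?G k \<noteq> FV A (k - 1)" for k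
  proof
    assume "S k = (\<lambda>v. 0)"
    then have "?G k = {T \<in> FV A k. T k = (\<lambda>v. 0)}" using eq by simp
    also have "\<dots> = FV A (k - 1)"
      using FV_mono[of "k - 1" k A] by (auto intro: FV_lower) (auto simp: FV_iff)
    finally show False using that by simp
  qed
  moreover have "?G k \<noteq> FV A (k - 1)" if "S k \<noteq> (\<lambda>v. 0)" for k
  proof
    assume *: "?G k = FV A (k - 1)"
    obtain T where T: "T \<in> ?G k" using ne[of k] by blast
    then have "T k = S k" unfolding eq by simp
    moreover have "T k = (\<lambda>v. 0)" using T * by (auto simp: FV_iff)
    ultimately show False using that by simp
  qed
  ultimately have "{k. ?G k \<noteq> FV A (k - 1)} = {k. S k \<noteq> (\<lambda>v. 0)}" by blast
  then show "gr_rho A f g v = (\<Sum>k | S k \<noteq> (\<lambda>v. 0). S k v)"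
    by (simp add: gr_rho_def gr_to_End_def comp)
qed

text \<open>Different symbols have different supports; a common finite index set allows their sums
  to be compared.\<close>

lemma gr_rho_eq_superset:
  assumes "gr_symbol A B f g S" "finite K" "\<And>k. k \<notin> K \<Longrightarrow> S k = (\<lambda>v. 0)"
  shows "gr_rho A f g v = (\<Sum>k\<in>K. S k v)"
  unfolding gr_rho_eq[OF assms(1)] using assms(2,3) by (intro sum.mono_neutral_left) auto

section \<open>The representation of the associated graded algebra induced by a filtered
  morphism\<close>

locale filtered_rep =
  fixes A :: "'i::finite \<Rightarrow> 'i \<Rightarrow> int" and B :: "'a calg" and F :: "int \<Rightarrow> 'a set"
    and f :: "'a \<Rightarrow> int \<Rightarrow> 'i vop"
  assumes ring: "ring B"
    and smult_closed: "x \<in> carrier B \<Longrightarrow> c \<odot>\<^bsub>B\<^esub> x \<in> carrier B"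
    and F_carrier: "F k \<subseteq> carrier B"
    and F_zero: "\<zero>\<^bsub>B\<^esub> \<in> F k"
    and filtered: "filtered_hom B F (tEnd A) (FV A) f"
begin

sublocale ring B by (rule ring)

lemma hom: "f \<in> alg_hom B (tEnd A)"
  using filtered by (simp add: filtered_hom_def)

lemma f_F: "x \<in> F k \<Longrightarrow> f x \<in> FV A k"
  using filtered by (auto simp: filtered_hom_def)

text \<open>Zero lies in every \<open>F k\<close>, so its image lies in every \<open>FV A k\<close>,
  and only zero does so.\<close>

lemma f_zero: "f \<zero>\<^bsub>B\<^esub> = (\<lambda>m v. 0)"
proof
  fix m
  have "f \<zero>\<^bsub>B\<^esub> \<in> FV A (m - 1)" by (intro f_F F_zero)
  then show "f \<zero>\<^bsub>B\<^esub> m = (\<lambda>v. 0)" by (simp add: FV_iff)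
qed

lemma f_add: "x \<in> carrier B \<Longrightarrow> y \<in> carrier B \<Longrightarrow> f (x \<oplus>\<^bsub>B\<^esub> y) m v = f x m v + f y m v"
  using alg_hom_memE(3)[OF hom, of x y] by simp

lemma f_finsum:
  assumes "finite K" "\<And>k. k \<in> K \<Longrightarrow> x k \<in> carrier B"
  shows "f (\<Oplus>\<^bsub>B\<^esub>k\<in>K. x k) m v = (\<Sum>k\<in>K. f (x k) m v)"
  using assms
proof (induction K rule: finite_induct)
  case (insert k K)
  then show ?case by (subst add.finprod_insert) (auto simp: f_add finsum_closed Pi_iff)
qed (simp add: f_zero)

text \<open>An element of step k - 1 is sent to something without component of degree k, so adding
  it leaves the top component alone.\<close>

lemma coset_symbol:
  assumes x: "x \<in> carrier B" "f x \<in> FV A k" and "y \<in> F (k - 1) +>\<^bsub>B\<^esub> x"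
  shows "y \<in> carrier B" "f y \<in> FV A k" "f y k = f x k"
proof -
  from assms(3) obtain u where u: "u \<in> F (k - 1)" "y = u \<oplus>\<^bsub>B\<^esub> x"
    by (auto simp: a_r_coset_def')
  then have uc: "u \<in> carrier B" using F_carrier by blast
  then show "y \<in> carrier B" using u x by simp
  have "f u \<in> FV A (k - 1)" using u f_F by blast
  then have fu: "f u \<in> FV A k" "f u k = (\<lambda>v. 0)" using FV_mono[of "k - 1" k A] by (auto simp: FV_iff)
  have "f y = f u \<oplus>\<^bsub>tEnd A\<^esub> f x"
    using alg_hom_memE(3)[OF hom uc x(1)] u by simp
  then show "f y \<in> FV A k" "f y k = f x k"
    using fu x(2) FV_add[OF fu(1) x(2)] by (simp, simp add: fun_eq_iff)
qed

lemma coset_nonempty: "F (k - 1) +>\<^bsub>B\<^esub> x \<noteq> {}"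
  using F_zero by (auto simp: a_r_coset_def')

text \<open>The last two conclusions serve products: \<open>gr_alg\<close> sums over the nonzero
  components of the first factor, which must be finite in number and contain the support of the
  symbol.\<close>

lemma symbol_exists:
  assumes g: "g \<in> carrier (gr_alg B F)"
  obtains S where "gr_symbol A B f g S" "\<And>k. g k = F (k - 1) \<Longrightarrow> S k = (\<lambda>v. 0)"
    "finite {k. g k \<noteq> F (k - 1)}"
proof -
  from g have "\<forall>k. \<exists>a. a \<in> F k \<and> g k = F (k - 1) +>\<^bsub>B\<^esub> a" and fin: "finite {k. g k \<noteq> F (k - 1)}"
    by (auto simp: gr_alg_def image_iff)
  then obtain a where a: "\<And>k. a k \<in> F k" "\<And>k. g k = F (k - 1) +>\<^bsub>B\<^esub> a k" by metis
  have ac: "a k \<in> carrier B" "f (a k) \<in> FV A k" for k using a F_carrier f_F by blast+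
  define S where "S k = f (a k) k" for k
  have *: "g k \<noteq> {}" "x \<in> g k \<Longrightarrow> x \<in> carrier B" "x \<in> g k \<Longrightarrow> f x \<in> FV A k"
    "x \<in> g k \<Longrightarrow> f x k = S k" for k x
    unfolding a(2) S_def using coset_nonempty coset_symbol[OF ac] by auto
  have z: "S k = (\<lambda>v. 0)" if "g k = F (k - 1)" for k
  proof -
    obtain x where "x \<in> g k" using *(1) by blast
    then have "f x \<in> FV A (k - 1)" "f x k = S k" using that f_F *(4) by auto
    then show ?thesis by (simp add: FV_iff)
  qed
  have "finite {k. S k \<noteq> (\<lambda>v. 0)}"
    by (rule finite_subset[OF _ fin]) (use z in auto)
  with * have "gr_symbol A B f g S" by (auto simp: gr_symbol_def)
  with z fin that show thesis by blast
qed

lemma gr_symbol_Endm: "gr_symbol A B f g S \<Longrightarrow> S k \<in> Endm A k"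
  unfolding gr_symbol_def by (metis FV_iff all_not_in_conv)

lemma gr_symbol_cls:
  assumes "a \<in> F k"
  shows "gr_symbol A B f (gr_cls B F k a) (\<lambda>m. if m = k then f a k else (\<lambda>v. 0))"
proof -
  have "finite {m. (if m = k then f a k else (\<lambda>v. 0)) \<noteq> (\<lambda>v. 0)}"
    by (rule finite_subset[of _ "{k}"]) auto
  moreover have "a \<in> carrier B" "f a \<in> FV A k" using assms F_carrier f_F by blast+
  note coset_symbol[OF this] coset_symbol[OF zero_closed f_F[OF F_zero]]
  ultimately show ?thesis
    unfolding gr_symbol_def gr_cls_def using coset_nonempty by (auto simp: f_zero)
qed

lemma gr_symbol_add:
  assumes "gr_symbol A B f g S" "gr_symbol A B f g' S'"
  shows "gr_symbol A B f (g \<oplus>\<^bsub>gr_alg B F\<^esub> g') (\<lambda>k v. S k v + S' k v)"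
proof -
  have "finite {k. (\<lambda>v. S k v + S' k v) \<noteq> (\<lambda>v. 0)}"
    by (rule finite_subset[of _ "{k. S k \<noteq> (\<lambda>v. 0)} \<union> {k. S' k \<noteq> (\<lambda>v. 0)}"])
      (use assms in \<open>auto simp: gr_symbol_def fun_eq_iff\<close>)
  moreover have "g k <+>\<^bsub>B\<^esub> g' k \<noteq> {}" for k
    using assms by (auto simp: gr_symbol_def set_add_def' ex_in_conv[symmetric])
  moreover have "x \<in> carrier B \<and> f x \<in> FV A k \<and> f x k = (\<lambda>v. S k v + S' k v)"
    if "x \<in> g k <+>\<^bsub>B\<^esub> g' k" for x k
  proof -
    from that obtain y z where yz: "y \<in> g k" "z \<in> g' k" "x = y \<oplus>\<^bsub>B\<^esub> z"
      by (auto simp: set_add_def')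
    then have c: "y \<in> carrier B" "z \<in> carrier B" and "f y \<in> FV A k" "f z \<in> FV A k"
      and e: "f y k = S k" "f z k = S' k"
      using assms by (auto simp: gr_symbol_def)
    then have "f x \<in> FV A k" using yz alg_hom_memE(3)[OF hom, of y z] by (simp add: FV_add)
    with c e show ?thesis using yz by (auto simp: f_add fun_eq_iff)
  qed
  ultimately show ?thesis
    unfolding gr_symbol_def by (auto simp: gr_alg_def)
qed

lemma gr_symbol_smult:
  assumes "gr_symbol A B f g S"
  shows "gr_symbol A B f (c \<odot>\<^bsub>gr_alg B F\<^esub> g) (\<lambda>k v. vscale c (S k v))"
proof -
  have fin: "finite {k. (\<lambda>v. vscale c (S k v)) \<noteq> (\<lambda>v. 0)}"
    by (rule finite_subset[of _ "{k. S k \<noteq> (\<lambda>v. 0)}"])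
      (use assms in \<open>auto simp: gr_symbol_def fun_eq_iff\<close>)
  have "y \<in> carrier B \<and> f y \<in> FV A k \<and> f y k = (\<lambda>v. vscale c (S k v))"
    if "x \<in> g k" "y \<in> F (k - 1) +>\<^bsub>B\<^esub> (c \<odot>\<^bsub>B\<^esub> x)" for x y k
  proof -
    have x: "x \<in> carrier B" "f x \<in> FV A k" "f x k = S k"
      using assms that(1) by (auto simp: gr_symbol_def)
    have fx: "f (c \<odot>\<^bsub>B\<^esub> x) = c \<odot>\<^bsub>tEnd A\<^esub> f x"
      by (rule alg_hom_memE(5)[OF hom x(1)])
    with x have "f (c \<odot>\<^bsub>B\<^esub> x) \<in> FV A k" by (simp add: FV_scale)
    from coset_symbol[OF smult_closed[OF x(1)] this that(2)] x fx
    show ?thesis by (auto simp: fun_eq_iff)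
  qed
  moreover have "(\<Union>x\<in>g k. F (k - 1) +>\<^bsub>B\<^esub> (c \<odot>\<^bsub>B\<^esub> x)) \<noteq> {}" for k
    using assms coset_nonempty by (fastforce simp: gr_symbol_def)
  ultimately show ?thesis
    using fin unfolding gr_symbol_def by (auto simp: gr_alg_def)
qed

lemma gr_symbol_mult:
  assumes g: "gr_symbol A B f g S" and g': "gr_symbol A B f g' S'"
    and fin: "finite {k. g k \<noteq> F (k - 1)}" and z: "\<And>k. g k = F (k - 1) \<Longrightarrow> S k = (\<lambda>v. 0)"
  shows "gr_symbol A B f (g \<otimes>\<^bsub>gr_alg B F\<^esub> g')
    (\<lambda>m v. \<Sum>k | g k \<noteq> F (k - 1). S k (S' (m - k) v))" (is "gr_symbol A B f _ ?P")
proof -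
  let ?K = "{k. g k \<noteq> F (k - 1)}" and ?L = "{l. S' l \<noteq> (\<lambda>v. 0)}"
  \<comment> \<open>Only sums of a degree from \<open>?K\<close> and a degree from \<open>?L\<close>
    can occur, so the product has finitely many nonzero components.\<close>
  have vanish: "?P m = (\<lambda>v. 0)" if "m \<notin> (\<lambda>(k, l). k + l) ` (?K \<times> ?L)" for m
  proof -
    have "S' (m - k) = (\<lambda>v. 0)" if "k \<in> ?K" for k
      using that \<open>m \<notin> _\<close> by (force simp: image_iff)
    then show ?thesis
      using vlinear_zero[OF Endm_vlinear[OF gr_symbol_Endm[OF g]]] by (auto intro!: sum.neutral)
  qed
  have "finite ?L" using g' by (simp add: gr_symbol_def)
  then have "finite ((\<lambda>(k, l). k + l) ` (?K \<times> ?L))" using fin by simp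
  then have fin_P: "finite {m. ?P m \<noteq> (\<lambda>v. 0)}"
    by (rule rev_finite_subset) (use vanish in blast)
  \<comment> \<open>All choices of representatives are treated at once: whatever \<open>a\<close>
    and \<open>b\<close> are, \<open>FV_mult\<close> gives each summand the top component built from
    S k and S' (m - k).\<close>
  have rep: "y \<in> carrier B \<and> f y \<in> FV A m \<and> f y m = ?P m"
    if ab: "\<forall>k. a k \<in> g k" "\<forall>k. b k \<in> g' k"
      and y: "y \<in> F (m - 1) +>\<^bsub>B\<^esub> (\<Oplus>\<^bsub>B\<^esub>k\<in>?K. a k \<otimes>\<^bsub>B\<^esub> b (m - k))" for a b y m
  proof -
    have a: "a k \<in> carrier B" "f (a k) \<in> FV A k" "f (a k) k = S k"
      and b: "b k \<in> carrier B" "f (b k) \<in> FV A k" "f (b k) k = S' k" for k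
      using gr_symbolD[OF g, of "a k" k] gr_symbolD[OF g', of "b k" k] ab by simp_all
    let ?s = "\<Oplus>\<^bsub>B\<^esub>k\<in>?K. a k \<otimes>\<^bsub>B\<^esub> b (m - k)"
    have sc: "?s \<in> carrier B" using a b by (auto intro!: finsum_closed)
    have fs: "f ?s = (\<lambda>n v. \<Sum>k\<in>?K. f (a k \<otimes>\<^bsub>B\<^esub> b (m - k)) n v)"
      using f_finsum[OF fin, of "\<lambda>k. a k \<otimes>\<^bsub>B\<^esub> b (m - k)"] a b by (simp add: fun_eq_iff)
    have fab: "f (a k \<otimes>\<^bsub>B\<^esub> b (m - k)) = f (a k) \<otimes>\<^bsub>tEnd A\<^esub> f (b (m - k))" for k
      using a b by (intro alg_hom_memE(2)[OF hom])
    have ab_FV: "f (a k \<otimes>\<^bsub>B\<^esub> b (m - k)) \<in> FV A m" for k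
      using FV_mult(1)[OF a(2) b(2), of k "m - k"] by (simp add: fab)
    have ab_top: "f (a k \<otimes>\<^bsub>B\<^esub> b (m - k)) m v = S k (S' (m - k) v)" for k v
      using FV_mult(2)[OF a(2) b(2), of k "m - k"] a b by (simp add: fab)
    have "f ?s \<in> FV A m"
      using ab_FV unfolding fs FV_iff by (auto intro!: Endm_sum sum.neutral)
    from coset_symbol[OF sc this y] show ?thesis
      by (simp add: fs ab_top fun_eq_iff)
  qed
  have ex: "\<exists>a b y. (\<forall>k. a k \<in> g k) \<and> (\<forall>k. b k \<in> g' k) \<and>
      y \<in> F (m - 1) +>\<^bsub>B\<^esub> (\<Oplus>\<^bsub>B\<^esub>k\<in>?K. a k \<otimes>\<^bsub>B\<^esub> b (m - k))" for m
  proof -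
    have "\<forall>k. \<exists>x. x \<in> g k" "\<forall>k. \<exists>x. x \<in> g' k"
      using g g' by (auto simp: gr_symbol_def)
    then obtain a b where ab: "\<forall>k. a k \<in> g k" "\<forall>k. b k \<in> g' k" by metis
    obtain y where "y \<in> F (m - 1) +>\<^bsub>B\<^esub> (\<Oplus>\<^bsub>B\<^esub>k\<in>?K. a k \<otimes>\<^bsub>B\<^esub> b (m - k))"
      using coset_nonempty by blast
    with ab show ?thesis by blast
  qed
  have mult_eq: "(g \<otimes>\<^bsub>gr_alg B F\<^esub> g') m = \<Union>{F (m - 1) +>\<^bsub>B\<^esub>
      (\<Oplus>\<^bsub>B\<^esub>k\<in>?K. a k \<otimes>\<^bsub>B\<^esub> b (m - k)) |a b. (\<forall>k. a k \<in> g k) \<and> (\<forall>k. b k \<in> g' k)}" for m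
    by (simp add: gr_alg_def)
  have ne: "(g \<otimes>\<^bsub>gr_alg B F\<^esub> g') m \<noteq> {}" for m
    unfolding mult_eq using ex[of m] by blast
  have comps: "y \<in> carrier B \<and> f y \<in> FV A m \<and> f y m = ?P m"
    if "y \<in> (g \<otimes>\<^bsub>gr_alg B F\<^esub> g') m" for y m
  proof -
    from that obtain a b where "\<forall>k. a k \<in> g k" "\<forall>k. b k \<in> g' k"
        "y \<in> F (m - 1) +>\<^bsub>B\<^esub> (\<Oplus>\<^bsub>B\<^esub>k\<in>?K. a k \<otimes>\<^bsub>B\<^esub> b (m - k))"
      unfolding mult_eq by blast
    then show ?thesis by (rule rep)
  qed
  show ?thesis
    unfolding gr_symbol_def using fin_P ne comps by blast
qed

text \<open>Every element of the graded algebra has a symbol, and symbols add, scale and convolve.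
  Summing a convolution over all degrees gives the composite of the two sums, which is
  multiplicativity.\<close>

lemma gr_rho_hom: "gr_rho A f \<in> alg_hom (gr_alg B F) EndV"
proof -
  have closed: "vlinear (gr_rho A f g)" if g: "g \<in> carrier (gr_alg B F)" for g
  proof -
    obtain S where S: "gr_symbol A B f g S"
      by (rule symbol_exists[OF g])
    show ?thesis
      unfolding gr_rho_eq[OF S] by (rule vlinear_sumI) (rule Endm_vlinear[OF gr_symbol_Endm[OF S]])
  qed
  have mult: "gr_rho A f (g \<otimes>\<^bsub>gr_alg B F\<^esub> g') = gr_rho A f g \<circ> gr_rho A f g'"
    if gg: "g \<in> carrier (gr_alg B F)" "g' \<in> carrier (gr_alg B F)" for g g'
  proof
    fix v
    obtain S where S: "gr_symbol A B f g S" "\<And>k. g k = F (k - 1) \<Longrightarrow> S k = (\<lambda>v. 0)"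
        "finite {k. g k \<noteq> F (k - 1)}"
      using symbol_exists[OF gg(1)] by blast
    obtain S' where S': "gr_symbol A B f g' S'"
      by (rule symbol_exists[OF gg(2)])
    let ?K = "{k. g k \<noteq> F (k - 1)}" and ?L = "{l. S' l \<noteq> (\<lambda>v. 0)}"
    have finL: "finite ?L" using S' by (simp add: gr_symbol_def)
    have lin: "vlinear (S k)" for k by (rule Endm_vlinear[OF gr_symbol_Endm[OF S(1)]])
    let ?M = "(\<lambda>(k, l). k + l) ` (?K \<times> ?L)"
    have finM: "finite ?M" using S(3) finL by simp
    \<comment> \<open>With k fixed, m = k + l reindexes the sum. Any other m in \<open>?M\<close>
      has m - k outside the support of S' and contributes 0.\<close>
    have shifted: "(\<Sum>m\<in>?M. S k (S' (m - k) v)) = (\<Sum>l\<in>?L. S k (S' l v))" if k: "k \<in> ?K" for k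
    proof -
      have "(\<Sum>l\<in>?L. S k (S' l v)) = (\<Sum>m\<in>(+) k ` ?L. S k (S' (m - k) v))"
        by (subst sum.reindex) auto
      also have "\<dots> = (\<Sum>m\<in>?M. S k (S' (m - k) v))"
      proof (rule sum.mono_neutral_left[OF finM])
        show "(+) k ` ?L \<subseteq> ?M" using k by auto
        show "\<forall>m\<in>?M - (+) k ` ?L. S k (S' (m - k) v) = 0"
        proof
          fix m assume "m \<in> ?M - (+) k ` ?L"
          then have "S' (m - k) = (\<lambda>v. 0)" by (force simp: image_iff)
          then show "S k (S' (m - k) v) = 0" by (simp add: vlinear_zero lin)
        qed
      qed
      finally show ?thesis by simp
    qed
    have "gr_rho A f (g \<otimes>\<^bsub>gr_alg B F\<^esub> g') v = (\<Sum>m\<in>?M. \<Sum>k\<in>?K. S k (S' (m - k) v))"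
    proof (rule gr_rho_eq_superset[OF gr_symbol_mult[OF S(1) S' S(3) S(2)] finM])
      fix m assume "m \<notin> ?M"
      then have "S' (m - k) = (\<lambda>v. 0)" if "k \<in> ?K" for k
        using that by (force simp: image_iff)
      then show "(\<lambda>v. \<Sum>k\<in>?K. S k (S' (m - k) v)) = (\<lambda>v. 0)"
        by (auto intro!: sum.neutral simp: vlinear_zero lin)
    qed
    also have "\<dots> = (\<Sum>k\<in>?K. \<Sum>l\<in>?L. S k (S' l v))"
      by (subst sum.swap) (auto intro!: sum.cong shifted)
    also have "\<dots> = (\<Sum>k\<in>?K. S k (gr_rho A f g' v))"
      by (simp add: gr_rho_eq[OF S'] vlinear_sum lin)
    also have "\<dots> = gr_rho A f g (gr_rho A f g' v)"
      using S by (intro gr_rho_eq_superset[symmetric]) auto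
    finally show "gr_rho A f (g \<otimes>\<^bsub>gr_alg B F\<^esub> g') v = (gr_rho A f g \<circ> gr_rho A f g') v" by simp
  qed
  have add: "gr_rho A f (g \<oplus>\<^bsub>gr_alg B F\<^esub> g') v = gr_rho A f g v + gr_rho A f g' v"
    if gg: "g \<in> carrier (gr_alg B F)" "g' \<in> carrier (gr_alg B F)" for g g' v
  proof -
    obtain S where S: "gr_symbol A B f g S"
      by (rule symbol_exists[OF gg(1)])
    obtain S' where S': "gr_symbol A B f g' S'"
      by (rule symbol_exists[OF gg(2)])
    define K where "K = {k. S k \<noteq> (\<lambda>v. 0)} \<union> {k. S' k \<noteq> (\<lambda>v. 0)}"
    have K: "finite K" "k \<notin> K \<Longrightarrow> S k = (\<lambda>v. 0)" "k \<notin> K \<Longrightarrow> S' k = (\<lambda>v. 0)" for k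
      using S S' by (auto simp: K_def gr_symbol_def)
    show ?thesis
      using gr_rho_eq_superset[OF S K(1)] gr_rho_eq_superset[OF S' K(1)]
        gr_rho_eq_superset[OF gr_symbol_add[OF S S'] K(1)] K(2,3) by (simp add: sum.distrib)
  qed
  have smult: "gr_rho A f (c \<odot>\<^bsub>gr_alg B F\<^esub> g) v = vscale c (gr_rho A f g v)"
    if g: "g \<in> carrier (gr_alg B F)" for c g v
  proof -
    obtain S where S: "gr_symbol A B f g S"
      by (rule symbol_exists[OF g])
    let ?K = "{k. S k \<noteq> (\<lambda>v. 0)}"
    have "finite ?K" using S by (simp add: gr_symbol_def)
    then have "gr_rho A f (c \<odot>\<^bsub>gr_alg B F\<^esub> g) v = (\<Sum>k\<in>?K. vscale c (S k v))"
      by (intro gr_rho_eq_superset[OF gr_symbol_smult[OF S]]) auto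
    then show ?thesis by (simp add: gr_rho_eq[OF S] V.scale_sum_right)
  qed
  have one: "gr_rho A f \<one>\<^bsub>gr_alg B F\<^esub> = id"
  proof
    fix v
    have f1: "f \<one>\<^bsub>B\<^esub> = \<one>\<^bsub>tEnd A\<^esub>" by (rule alg_hom_memE(4)[OF hom])
    have "f \<one>\<^bsub>B\<^esub> \<in> FV A 0" using FV_one[of A] by (simp only: f1)
    note c = coset_symbol[OF one_closed this] coset_symbol[OF zero_closed f_F[OF F_zero]]
    have "finite {m::int. (if m = 0 then id else (\<lambda>v::'i vsp. 0)) \<noteq> (\<lambda>v. 0)}"
      by (rule finite_subset[of _ "{0}"]) auto
    then have "gr_symbol A B f \<one>\<^bsub>gr_alg B F\<^esub> (\<lambda>m. if m = 0 then id else (\<lambda>v. 0))"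
      unfolding gr_symbol_def using coset_nonempty c by (auto simp: gr_alg_def f_zero f1)
    from gr_rho_eq_superset[OF this, of "{0}" v] show "gr_rho A f \<one>\<^bsub>gr_alg B F\<^esub> v = id v" by simp
  qed
  show ?thesis
    unfolding alg_hom_def ring_hom_def
    by (auto simp: EndV_def closed mult add smult one intro!: ext)
qed

lemma gr_rho_cls:
  assumes "a \<in> F k"
  shows "gr_rho A f (gr_cls B F k a) = f a k"
proof
  show "gr_rho A f (gr_cls B F k a) v = f a k v" for v
    by (subst gr_rho_eq_superset[OF gr_symbol_cls[OF assms], of "{k}"]) auto
qed

end

section \<open>Degrees of the vertex operators\<close>

lemma lookup_mulH [simp]: "Poly_Mapping.lookup (mulH f v) \<beta> = f * Poly_Mapping.lookup v \<beta>"
  by (simp add: mulH_def Poly_Mapping.map.rep_eq when_def)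

lemma mulH_zero: "mulH 0 = (\<lambda>v. 0)" "mulH f 0 = 0"
  by (rule ext, rule poly_mapping_eqI, simp) (rule poly_mapping_eqI, simp)

lemma mulH_one: "mulH 1 v = v"
  by (rule poly_mapping_eqI) simp

lemma mulH_mulH: "mulH f (mulH g v) = mulH (f * g) v"
  by (rule poly_mapping_eqI) (simp add: mult.assoc)

lemma mulH_sum: "mulH (\<Sum>a\<in>B. f a) v = (\<Sum>a\<in>B. mulH (f a) v)"
  by (rule poly_mapping_eqI) (simp add: lookup_sum sum_distrib_right)

lemma vscale_mulH: "vscale c (mulH f v) = mulH (c \<cdot> f) v"
  by (rule poly_mapping_eqI) (simp add: pscale_mult_left)

lemma foldr_mulH: "foldr (\<lambda>r. mulH (f r)) rs v = mulH (prod_list (map f rs)) v"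
  by (induction rs) (simp_all add: mulH_one mulH_mulH)

lemma lookup_Vproj:
  "Poly_Mapping.lookup (Poly_Mapping.lookup (Vproj A n v) \<beta>) m =
     (if vdeg A \<beta> m = n then Poly_Mapping.lookup (Poly_Mapping.lookup v \<beta>) m else 0)"
proof -
  let ?M = "\<lambda>\<beta>. {m \<in> Poly_Mapping.keys (Poly_Mapping.lookup v \<beta>). vdeg A \<beta> m = n}"
  have "Poly_Mapping.lookup (Poly_Mapping.lookup (Vproj A n v) \<beta>) m =
      (\<Sum>\<beta>'\<in>Poly_Mapping.keys v. \<Sum>m'\<in>?M \<beta>'. Poly_Mapping.lookup (Poly_Mapping.lookup
        (Poly_Mapping.single \<beta>' (Poly_Mapping.single m' (Poly_Mapping.lookup (Poly_Mapping.lookup v \<beta>') m'))) \<beta>) m)"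
    by (simp add: Vproj_def lookup_sum)
  also have "\<dots> = (\<Sum>\<beta>'\<in>Poly_Mapping.keys v. if \<beta>' = \<beta> then
         (\<Sum>m'\<in>?M \<beta>. if m' = m then Poly_Mapping.lookup (Poly_Mapping.lookup v \<beta>) m else 0) else 0)"
    by (intro sum.cong refl) (auto simp: lookup_single when_def intro!: sum.cong)
  also have "\<dots> = (if vdeg A \<beta> m = n then Poly_Mapping.lookup (Poly_Mapping.lookup v \<beta>) m else 0)"
    by (simp add: sum.delta in_keys_iff)
  finally show ?thesis .
qed

lemma Vproj_Vgr: "Vproj A n v \<in> Vgr A n"
  by (auto simp: Vgr_def lookup_Vproj in_keys_iff split: if_splits)

lemma Vproj_of_Vgr:
  assumes "v \<in> Vgr A k"
  shows "Vproj A n v = (if n = k then v else 0)"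
proof (rule vsp_eqI)
  fix \<beta> m
  have "Poly_Mapping.lookup (Poly_Mapping.lookup v \<beta>) m = 0 \<or> vdeg A \<beta> m = k"
    using assms in_keys_iff[of m "Poly_Mapping.lookup v \<beta>"] unfolding Vgr_def by blast
  then show "Poly_Mapping.lookup (Poly_Mapping.lookup (Vproj A n v) \<beta>) m =
      Poly_Mapping.lookup (Poly_Mapping.lookup (if n = k then v else 0) \<beta>) m"
    by (auto simp: lookup_Vproj)
qed

lemma Sum_any_Vproj:
  shows "finite {n. Vproj A n v \<noteq> 0}" and "Sum_any (\<lambda>n. Vproj A n v) = v"
proof -
  \<comment> \<open>The degrees of the monomials occurring in v: a finite set outside which all
    projections of v vanish.\<close>
  define N where "N = (\<Union>\<beta>\<in>Poly_Mapping.keys v. vdeg A \<beta> ` Poly_Mapping.keys (Poly_Mapping.lookup v \<beta>))"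
  have fin: "finite N" by (simp add: N_def)
  have N: "vdeg A \<beta> m \<in> N" if "Poly_Mapping.lookup (Poly_Mapping.lookup v \<beta>) m \<noteq> 0" for \<beta> m
    using that unfolding N_def by (fastforce simp: in_keys_iff)
  have sub: "{n. Vproj A n v \<noteq> 0} \<subseteq> N"
  proof
    fix n assume "n \<in> {n. Vproj A n v \<noteq> 0}"
    then obtain \<beta> m where "Poly_Mapping.lookup (Poly_Mapping.lookup (Vproj A n v) \<beta>) m \<noteq> 0"
      using vsp_eqI[of "Vproj A n v" 0] by auto
    then show "n \<in> N" using N by (auto simp: lookup_Vproj split: if_splits)
  qed
  with fin show "finite {n. Vproj A n v \<noteq> 0}" by (rule rev_finite_subset)
  have "Sum_any (\<lambda>n. Vproj A n v) = (\<Sum>n\<in>N. Vproj A n v)"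
    by (rule Sum_any.expand_superset[OF fin sub])
  also have "\<dots> = v"
  proof (rule vsp_eqI)
    fix \<beta> m
    have "Poly_Mapping.lookup (Poly_Mapping.lookup (\<Sum>n\<in>N. Vproj A n v) \<beta>) m =
        (\<Sum>n\<in>N. if n = vdeg A \<beta> m then Poly_Mapping.lookup (Poly_Mapping.lookup v \<beta>) m else 0)"
      by (simp add: lookup_sum lookup_Vproj eq_commute cong: if_cong)
    then show "Poly_Mapping.lookup (Poly_Mapping.lookup (\<Sum>n\<in>N. Vproj A n v) \<beta>) m =
        Poly_Mapping.lookup (Poly_Mapping.lookup v \<beta>) m"
      using N[of \<beta> m] fin by (auto simp: sum.delta)
  qed
  finally show "Sum_any (\<lambda>n. Vproj A n v) = v" .
qed

text \<open>The image of each homogeneous projection of v has a single degree, so the outer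
  projection keeps all or nothing of it; the projections of v then add up to v again. The
  coefficients of the second and third factors of the vertex operators are of this kind.\<close>

lemma hcomps_homogeneous:
  assumes F: "F p \<in> Endm A d"
  shows "hcomps A F p m = (if m = d then F p else (\<lambda>v. 0))"
proof
  fix v
  have lin: "vlinear (F p)" by (rule Endm_vlinear[OF F])
  have "F p (Vproj A n v) \<in> Vgr A (n + d)" for n
    using F Vproj_Vgr[of A n v] by (auto simp: Endm_def)
  then have "Vproj A (n + m) (F p (Vproj A n v)) = (if m = d then F p (Vproj A n v) else 0)" for n
    by (simp add: Vproj_of_Vgr [where k = "n + d"])
  then have "hcomps A F p m v = Sum_any (\<lambda>n. if m = d then F p (Vproj A n v) else 0)"
    by (simp add: hcomps_def)
  also have "\<dots> = (if m = d then F p else (\<lambda>v. 0)) v"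
  proof -
    let ?N = "{n. Vproj A n v \<noteq> 0}"
    have "Sum_any (\<lambda>n. F p (Vproj A n v)) = (\<Sum>n\<in>?N. F p (Vproj A n v))"
      by (rule Sum_any.expand_superset[OF Sum_any_Vproj(1)]) (use vlinear_zero[OF lin] in force)
    also have "\<dots> = F p (Sum_any (\<lambda>n. Vproj A n v))"
      by (simp add: vlinear_sum[OF lin] Sum_any.expand_set)
    finally show ?thesis by (simp add: Sum_any_Vproj)
  qed
  finally show "hcomps A F p m v = (if m = d then F p else (\<lambda>v. 0)) v" .
qed

section \<open>Derivations and the series B\<close>

lemma pdiff_zero [simp]: "pdiff x 0 = 0"
  by (simp add: pdiff_def)

lemma lookup_pdiff:
  "Poly_Mapping.lookup (pdiff x f) m =
     of_nat (Poly_Mapping.lookup m x + 1) * Poly_Mapping.lookup f (m + Poly_Mapping.single x 1)"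
proof -
  let ?s = "Poly_Mapping.single x (1::nat)"
  \<comment> \<open>Subtraction of exponents is truncated, but monomials without x carry the factor
    0, so the equivalence matters only where x occurs.\<close>
  have "m' - ?s = m \<longleftrightarrow> m' = m + ?s" if "Poly_Mapping.lookup m' x \<noteq> 0" for m'
  proof
    assume "m' - ?s = m"
    then show "m' = m + ?s"
      using that by (auto intro!: poly_mapping_eqI simp: lookup_add lookup_minus lookup_single when_def)
  qed simp
  then have "Poly_Mapping.lookup (pdiff x f) m = (\<Sum>m'\<in>Poly_Mapping.keys f.
      if m' = m + ?s then of_nat (Poly_Mapping.lookup m x + 1) * Poly_Mapping.lookup f (m + ?s) else 0)"
    unfolding pdiff_def lookup_sum lookup_single when_def
    by (intro sum.cong refl) (auto simp: lookup_add)
  also have "\<dots> = of_nat (Poly_Mapping.lookup m x + 1) * Poly_Mapping.lookup f (m + ?s)"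
    by (simp add: in_keys_iff)
  finally show ?thesis .
qed

lemma vdeg_plus_single: "vdeg A \<beta> (m + Poly_Mapping.single x 1) = vdeg A \<beta> m - (int (snd x) + 1)"
proof -
  have "(\<Sum>y\<in>Poly_Mapping.keys (m + Poly_Mapping.single x 1).
        int (Poly_Mapping.lookup (m + Poly_Mapping.single x 1) y) * (int (snd y) + 1)) =
      (\<Sum>y\<in>Poly_Mapping.keys m. int (Poly_Mapping.lookup m y) * (int (snd y) + 1)) +
      (\<Sum>y\<in>Poly_Mapping.keys (Poly_Mapping.single x (1::nat)).
        int (Poly_Mapping.lookup (Poly_Mapping.single x 1) y) * (int (snd y) + 1))"
    by (rule setsum_keys_plus_distrib) (simp_all add: algebra_simps)
  then show ?thesis by (simp add: vdeg_def)
qed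

lemma lookup_annH:
  "Poly_Mapping.lookup (Poly_Mapping.lookup (annH i r v) \<beta>) m = of_nat r * (of_nat (Poly_Mapping.lookup m (i, r - 1) + 1)
     * Poly_Mapping.lookup (Poly_Mapping.lookup v \<beta>) (m + Poly_Mapping.single (i, r - 1) 1))"
proof -
  have "Poly_Mapping.lookup (annH i r v) \<beta> = of_nat r \<cdot> pdiff (i, r - 1) (Poly_Mapping.lookup v \<beta>)"
    by (simp add: annH_def Poly_Mapping.map.rep_eq when_def)
  then show ?thesis by (simp add: lookup_pdiff)
qed

lemma annH_Endm:
  assumes "r > 0"
  shows "annH i r \<in> Endm A (int r)"
proof -
  have "vlinear (annH i r)"
    unfolding vlinear_iff by (auto intro!: vsp_eqI simp: lookup_annH lookup_add algebra_simps)
  moreover have "annH i r v \<in> Vgr A (n + int r)" if v: "v \<in> Vgr A n" for v n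
    unfolding Vgr_def
  proof (intro CollectI allI ballI)
    fix \<beta> m assume "m \<in> Poly_Mapping.keys (Poly_Mapping.lookup (annH i r v) \<beta>)"
    then have "m + Poly_Mapping.single (i, r - 1) 1 \<in> Poly_Mapping.keys (Poly_Mapping.lookup v \<beta>)"
      by (auto simp: in_keys_iff lookup_annH)
    then have "vdeg A \<beta> (m + Poly_Mapping.single (i, r - 1) 1) = n"
      using v by (auto simp: Vgr_def)
    then show "vdeg A \<beta> m = n + int r" using assms vdeg_plus_single[of A \<beta> m "(i, r - 1)"] by simp
  qed
  ultimately show ?thesis by (auto simp: Endm_def)
qed

text \<open>Each composition of n yields a product of operators whose degrees add up to n.\<close>

lemma exp_op_Endm:
  assumes "\<And>r. r > 0 \<Longrightarrow> a r \<in> Endm A (int r)"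
  shows "exp_op a n \<in> Endm A (int n)"
proof -
  have "0 \<notin> set rs \<Longrightarrow> foldr a rs \<in> Endm A (int (sum_list rs))" for rs
  proof (induction rs)
    case (Cons r rs)
    then have "(\<lambda>v. a r (foldr a rs v)) \<in> Endm A (int r + int (sum_list rs))"
      by (intro Endm_comp assms) auto
    then show ?case by (simp add: comp_def)
  qed (simp add: Endm_closed)
  then have "(\<lambda>v. vscale (1 / fact (length rs)) (foldr a rs v)) \<in> Endm A (int n)"
    if "rs \<in> compositions n" for rs
    using that by (intro Endm_closed(4)) (auto simp: compositions_def)
  from Endm_sum[OF this] show ?thesis
    by (simp add: exp_op_def [abs_def])
qed

lemma Bser_Endm: "Bser s i p \<in> Endm A (- p)"
proof -
  have "(\<lambda>v. vscale (- sg s / of_nat r) (annH i r v)) \<in> Endm A (int r)" if "r > 0" for r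
    by (intro Endm_closed(4) annH_Endm that)
  from exp_op_Endm[OF this, of "nat (- p)"] show ?thesis
    by (auto simp: Bser_def Endm_closed(1))
qed

section \<open>The lattice form and the series of e^alpha z^(partial_alpha)\<close>

lemma form_add: "form A (\<alpha> + \<beta>) \<gamma> = form A \<alpha> \<gamma> + form A \<beta> \<gamma>"
  "form A \<gamma> (\<alpha> + \<beta>) = form A \<gamma> \<alpha> + form A \<gamma> \<beta>"
  by (simp_all add: form_def lookup_add algebra_simps sum.distrib)

lemma form_uminus: "form A (- \<alpha>) \<gamma> = - form A \<alpha> \<gamma>" "form A \<gamma> (- \<alpha>) = - form A \<gamma> \<alpha>"
  by (simp_all add: form_def sum_negf)

lemma form_commute:
  assumes "\<And>i j. A i j = A j i"
  shows "form A \<alpha> \<beta> = form A \<beta> \<alpha>"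
  unfolding form_def by (subst sum.swap) (simp add: assms mult.commute mult.left_commute)

lemma form_simple_root: "form A (simple_root i) (simple_root j) = A i j"
proof -
  have "form A (simple_root i) (simple_root j) =
      (\<Sum>k\<in>UNIV. if k = i then (\<Sum>l\<in>UNIV. A i l * (if l = j then 1 else 0)) else 0)"
    unfolding form_def simple_root_def
    by (intro sum.cong refl) (auto simp: lookup_single when_def eq_commute)
  also have "\<dots> = (\<Sum>l\<in>UNIV. if l = j then A i l else 0)"
    by (simp add: if_distrib [where f = "(*) _"] cong: if_cong)
  finally show ?thesis by simp
qed

lemma lookup_eop: "Poly_Mapping.lookup (eop \<epsilon> \<alpha> v) \<gamma> = \<epsilon> \<alpha> (\<gamma> - \<alpha>) \<cdot> Poly_Mapping.lookup v (\<gamma> - \<alpha>)"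
proof -
  have "Poly_Mapping.lookup (eop \<epsilon> \<alpha> v) \<gamma> = (\<Sum>\<beta>\<in>Poly_Mapping.keys v.
      if \<beta> = \<gamma> - \<alpha> then \<epsilon> \<alpha> (\<gamma> - \<alpha>) \<cdot> Poly_Mapping.lookup v (\<gamma> - \<alpha>) else 0)"
    unfolding eop_def lookup_sum lookup_single when_def by (intro sum.cong) (auto simp: algebra_simps)
  then show ?thesis by (simp add: in_keys_iff)
qed

lemma lookup_zpow:
  "Poly_Mapping.lookup (zpow A \<alpha> p v) \<beta> = (if form A \<alpha> \<beta> = p then Poly_Mapping.lookup v \<beta> else 0)"
proof -
  have "Poly_Mapping.lookup (zpow A \<alpha> p v) \<beta> =
      (\<Sum>\<beta>' | \<beta>' \<in> Poly_Mapping.keys v \<and> form A \<alpha> \<beta>' = p.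
        if \<beta>' = \<beta> then Poly_Mapping.lookup v \<beta> else 0)"
    unfolding zpow_def lookup_sum lookup_single when_def by (intro sum.cong) auto
  then show ?thesis by (simp add: in_keys_iff)
qed

text \<open>On e^beta with (alpha, beta) = p, passing to alpha + beta changes half the norm by p +
  1, because (alpha, alpha) = 2.\<close>

lemma Eser_Endm:
  assumes "simply_laced A"
  shows "Eser A \<epsilon> s i p \<in> Endm A (- p - 1)"
proof -
  define \<alpha> where "\<alpha> = (case s of Pl \<Rightarrow> simple_root i | Mi \<Rightarrow> - simple_root i)"
  have E: "Eser A \<epsilon> s i p v = eop \<epsilon> \<alpha> (zpow A \<alpha> p v)" for v
    by (simp add: Eser_def \<alpha>_def Let_def)
  have aa: "form A \<alpha> \<alpha> = 2"
    using assms by (simp add: \<alpha>_def form_uminus form_simple_root simply_laced_def split: pm.split)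
  have "vlinear (Eser A \<epsilon> s i p)"
    unfolding vlinear_iff E
    by (auto intro!: vsp_eqI simp: lookup_eop lookup_zpow lookup_add algebra_simps)
  moreover have "Eser A \<epsilon> s i p v \<in> Vgr A (n + (- p - 1))" if v: "v \<in> Vgr A n" for v n
    unfolding Vgr_def
  proof (intro CollectI allI ballI)
    fix \<gamma> m assume m: "m \<in> Poly_Mapping.keys (Poly_Mapping.lookup (Eser A \<epsilon> s i p v) \<gamma>)"
    define \<beta> where "\<beta> = \<gamma> - \<alpha>"
    from m have p: "form A \<alpha> \<beta> = p" and "m \<in> Poly_Mapping.keys (Poly_Mapping.lookup v \<beta>)"
      by (auto simp: in_keys_iff E lookup_eop lookup_zpow \<beta>_def split: if_splits)
    then have "vdeg A \<beta> m = n" using v by (auto simp: Vgr_def)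
    \<comment> \<open>The norms differ by an even number, so the integer division in
      \<open>vdeg\<close> changes by exactly p + 1.\<close>
    moreover have "form A \<gamma> \<gamma> = form A \<beta> \<beta> + 2 * (p + 1)"
    proof -
      have "\<gamma> = \<alpha> + \<beta>" by (simp add: \<beta>_def)
      moreover have "form A \<beta> \<alpha> = p"
        using p form_commute[of A \<beta> \<alpha>] assms by (simp add: simply_laced_def)
      ultimately show ?thesis using p aa by (simp add: form_add)
    qed
    ultimately show "vdeg A \<gamma> m = n + (- p - 1)" by (simp add: vdeg_def)
  qed
  ultimately show ?thesis by (auto simp: Endm_def)
qed

section \<open>Leading terms of the vertex operators\<close>

text \<open>The bounds m and n need not be the actual degrees. In the convolution every index other
  than m pushes one of the two factors beyond its bound.\<close>

lemma coeff_mult_degree_bound: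
  assumes "degree p \<le> m" "degree q \<le> n"
  shows "coeff (p * q) (m + n) = coeff p m * coeff q n"
proof -
  have "coeff p k * coeff q (m + n - k) = 0" if "k \<noteq> m" "k \<le> m + n" for k
  proof (cases "k < m")
    case True
    then have "degree q < m + n - k" using assms by linarith
    then show ?thesis by (simp add: coeff_eq_0)
  next
    case False
    then have "degree p < k" using assms that by linarith
    then show ?thesis by (simp add: coeff_eq_0)
  qed
  then have "(\<Sum>k\<le>m + n. coeff p k * coeff q (m + n - k)) =
      (\<Sum>k\<in>{m}. coeff p k * coeff q (m + n - k))"
    by (intro sum.mono_neutral_right) auto
  then show ?thesis by (simp add: coeff_mult)
qed

lemma prod_list_degree_bound:
  fixes a :: "nat \<Rightarrow> 'a::comm_semiring_1 poly"
  assumes "\<And>r. degree (a r) \<le> r"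
  shows "degree (prod_list (map a rs)) \<le> sum_list rs"
    and "coeff (prod_list (map a rs)) (sum_list rs) = prod_list (map (\<lambda>r. coeff (a r) r) rs)"
proof -
  show deg: "degree (prod_list (map a rs)) \<le> sum_list rs" for rs
  proof (induction rs)
    case (Cons r rs)
    then show ?case using degree_mult_le[of "a r" "prod_list (map a rs)"] assms[of r] by simp
  qed simp
  show "coeff (prod_list (map a rs)) (sum_list rs) = prod_list (map (\<lambda>r. coeff (a r) r) rs)"
    by (induction rs) (simp_all add: coeff_mult_degree_bound[OF assms deg])
qed

text \<open>A shift does not affect the coefficient of z^r. The two powers attached to i contribute
  2 and each neighbour contributes -1, which are the values (alpha_i, alpha_j) in
  \<open>Htilde\<close>.\<close>

lemma Aexponent_top:
  assumes A: "simply_laced A"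
  shows "degree (Aexponent A s i r) \<le> r"
    and "coeff (Aexponent A s i r) r = (sg s / of_nat r) \<cdot> Htilde A i r"
proof -
  have deg: "degree ([:a, 1:] ^ r :: 'i hpoly poly) \<le> r" for a by (simp add: degree_linear_power)
  show "degree (Aexponent A s i r) \<le> r"
    unfolding Aexponent_def
    by (intro degree_diff_le degree_sum_le order.trans[OF degree_smult_le] degree_add_le deg) simp
  let ?N = "{j. j \<noteq> i \<and> A i j \<noteq> 0}"
  have "Htilde A i r = (\<Sum>j\<in>insert i ?N. of_int (A i j) \<cdot> Hv j r)"
    unfolding Htilde_def form_simple_root by (intro sum.mono_neutral_right) auto
  also have "\<dots> = of_int (A i i) \<cdot> Hv i r + (\<Sum>j\<in>?N. of_int (A i j) \<cdot> Hv j r)"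
    by (subst sum.insert) auto
  also have "(\<Sum>j\<in>?N. of_int (A i j) \<cdot> Hv j r) = (\<Sum>j\<in>?N. (- 1) \<cdot> Hv j r)"
  proof (intro sum.cong refl)
    fix j assume "j \<in> ?N"
    moreover have "i \<noteq> j \<longrightarrow> A i j \<in> {0, - 1}"
      using A unfolding simply_laced_def by blast
    ultimately have "A i j = - 1" by auto
    then show "of_int (A i j) \<cdot> Hv j r = (- 1) \<cdot> Hv j r" by simp
  qed
  finally have Ht: "Htilde A i r = 2 \<cdot> Hv i r - (\<Sum>j\<in>?N. Hv j r)"
    using A by (simp add: simply_laced_def pscale_minus_one sum_negf)
  \<comment> \<open>The two leading coefficients 1 + 1 appear as a numeral of the polynomial ring;
    this turns it into a scalar.\<close>
  have two: "x * 2 = 2 \<cdot> x" for x :: "'i hpoly"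
    by (rule poly_mapping_eqI) (simp only: mult_2_right lookup_add lookup_pscale, simp)
  have "coeff (Aexponent A s i r) r =
      2 \<cdot> (sg s / of_nat r) \<cdot> Hv i r - (\<Sum>j\<in>?N. (sg s / of_nat r) \<cdot> Hv j r)"
    by (simp add: Aexponent_def coeff_sum coeff_linear_power two)
  also have "\<dots> = (sg s / of_nat r) \<cdot> Htilde A i r"
    unfolding Ht
    by (rule poly_mapping_eqI)
      (simp add: lookup_minus lookup_sum sum_distrib_left right_diff_distrib)
  finally show "coeff (Aexponent A s i r) r = (sg s / of_nat r) \<cdot> Htilde A i r" .
qed

text \<open>The part of weight n = -l is a combination of products over compositions of n, each a
  polynomial in z of degree at most n.\<close>

lemma Aser_vanish:
  assumes A: "simply_laced A" and "q > - l"
  shows "Aser A s i q l = (\<lambda>v. 0)"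
proof (cases "q \<ge> 0 \<and> l \<le> 0")
  case True
  have "degree (Polynomial.smult c (prod_list (map (Aexponent A s i) rs))) < nat q"
    if "rs \<in> compositions (nat (- l))" for rs c
    using prod_list_degree_bound(1)[of "Aexponent A s i" rs, OF Aexponent_top(1)[OF A]] that True assms(2)
      degree_smult_le[of c "prod_list (map (Aexponent A s i) rs)"]
    by (auto simp: compositions_def)
  then have "coeff (exp_poly (Aexponent A s i) (nat (- l))) (nat q) = 0"
    unfolding exp_poly_def coeff_sum by (intro sum.neutral ballI coeff_eq_0) auto
  then show ?thesis by (simp add: Aser_def mulH_zero)
qed (auto simp: Aser_def)

text \<open>When the power of z equals the weight, each product contributes the product of the top
  coefficients of its factors. This removes the shifts inside the exponential.\<close>

lemma Aser_top:
  assumes A: "simply_laced A"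
  shows "Aser A s i q (- q) = Aring_ser A s i q"
proof (cases "q \<ge> 0")
  case True
  let ?c = "\<lambda>r. (sg s / of_nat r) \<cdot> Htilde A i r"
  have "mulH (coeff (exp_poly (Aexponent A s i) (nat q)) (nat q)) v = exp_op (\<lambda>r. mulH (?c r)) (nat q) v" for v
    unfolding exp_poly_def exp_op_def coeff_sum mulH_sum foldr_mulH vscale_mulH
  proof (intro sum.cong refl)
    fix rs assume "rs \<in> compositions (nat q)"
    then have "nat q = sum_list rs" by (simp add: compositions_def)
    then show "mulH (coeff (Polynomial.smult ((1 / fact (length rs)) \<cdot> 1) (prod_list (map (Aexponent A s i) rs))) (nat q)) v =
        mulH ((1 / fact (length rs)) \<cdot> prod_list (map ?c rs)) v"
      by (simp add: prod_list_degree_bound(2) Aexponent_top[OF A] pscale_mult_left)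
  qed
  with True show ?thesis by (auto simp: Aser_def Aring_ser_def)
qed (simp add: Aser_def Aring_ser_def)

text \<open>Both factors have homogeneous coefficients: q forces the degree -q on the first and q -
  p - 1 on the second. The sum over pairs thus collapses to a sum over q, in total degree -p -
  1.\<close>

lemma tser_prod_BE:
  assumes "simply_laced A"
  shows "tser_prod (hcomps A (Bser s i)) (hcomps A (Eser A \<epsilon> s i)) p m =
    (if m = - p - 1 then ser_prod (Bser s i) (Eser A \<epsilon> s i) p else (\<lambda>v. 0))"
proof
  fix v
  let ?t = "\<lambda>q. if m = - p - 1 then Bser s i q (Eser A \<epsilon> s i (p - q) v) else 0"
  have "hcomps A (Bser s i) q l (hcomps A (Eser A \<epsilon> s i) (p - q) (m - l) v) = (?t q when l = - q)" for q l
    using vlinear_zero[OF Endm_vlinear[OF Bser_Endm[of s i _ A]]]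
    by (auto simp: hcomps_homogeneous[OF Bser_Endm] hcomps_homogeneous[OF Eser_Endm[OF assms]] when_def)
  then have "tser_prod (hcomps A (Bser s i)) (hcomps A (Eser A \<epsilon> s i)) p m v =
      Sum_any (\<lambda>(q, l). ?t q when l = - q)"
    by (simp add: tser_prod_def)
  also have "\<dots> = Sum_any ?t" by (rule Sum_any_when_dependent_prod_right)
  finally show "tser_prod (hcomps A (Bser s i)) (hcomps A (Eser A \<epsilon> s i)) p m v =
      (if m = - p - 1 then ser_prod (Bser s i) (Eser A \<epsilon> s i) p else (\<lambda>v. 0)) v"
    by (simp add: ser_prod_def)
qed

text \<open>A pair (q, l) from the first factor meets a remaining factor of degree r + q, so it
  contributes in degree m = r + (q + l). \<open>Aser_vanish\<close> forces q + l <= 0; the extreme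
  case l = -q is the leading term of \<open>Aser_top\<close>.\<close>

lemma rho_x_degree:
  assumes A: "simply_laced A"
  shows "m > r \<Longrightarrow> rho_x A \<epsilon> s i r m = (\<lambda>v. 0)"
    and "rho_x A \<epsilon> s i r r = Xring A \<epsilon> s i r"
proof -
  let ?BE = "ser_prod (Bser s i) (Eser A \<epsilon> s i)"
  have A0: "Aser A s i q l 0 = 0" for q l by (simp add: Aser_def mulH_zero)
  have eq: "rho_x A \<epsilon> s i r m v = vscale (sg s) (Sum_any (\<lambda>(q, l).
      if m - l = r + q then Aser A s i q l (?BE (- r - 1 - q) v) else 0))" for m v
  proof -
    have "Aser A s i q l (tser_prod (hcomps A (Bser s i)) (hcomps A (Eser A \<epsilon> s i)) (- r - 1 - q) (m - l) v) =
        (if m - l = r + q then Aser A s i q l (?BE (- r - 1 - q) v) else 0)" for q l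
      by (auto simp: tser_prod_BE[OF A] A0)
    then show ?thesis
      unfolding rho_x_def by (subst tser_prod_def) simp
  qed
  show "rho_x A \<epsilon> s i r m = (\<lambda>v. 0)" if "m > r"
  proof
    fix v
    have "(if m - l = r + q then Aser A s i q l (?BE (- r - 1 - q) v) else 0) = 0" for q l
      using that Aser_vanish[OF A, of l q s i] by auto
    then show "rho_x A \<epsilon> s i r m v = 0" unfolding eq by (simp add: case_prod_unfold)
  qed
  show "rho_x A \<epsilon> s i r r = Xring A \<epsilon> s i r"
  proof
    fix v
    let ?t = "\<lambda>q. Aring_ser A s i q (?BE (- r - 1 - q) v)"
    have "(if r - l = r + q then Aser A s i q l (?BE (- r - 1 - q) v) else 0) = (?t q when l = - q)" for q l
      using Aser_top[OF A, of s i q] by (auto simp: when_def)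
    then have "rho_x A \<epsilon> s i r r v = vscale (sg s) (Sum_any (\<lambda>(q, l). ?t q when l = - q))"
      unfolding eq by simp
    also have "\<dots> = vscale (sg s) (Sum_any ?t)" by (simp only: Sum_any_when_dependent_prod_right)
    also have "\<dots> = Xring A \<epsilon> s i r v"
      by (simp add: Xring_def ser_prod_def[of "Aring_ser A s i"])
    finally show "rho_x A \<epsilon> s i r r v = Xring A \<epsilon> s i r v" .
  qed
qed

section \<open>Generation of the enveloping algebra\<close>

lemma env_rels_carrier: "env_rels R \<subseteq> carrier (free_alg (range (lie_cls R)))"
proof
  fix u assume "u \<in> env_rels R"
  then show "u \<in> carrier (free_alg (range (lie_cls R)))"
    by cases (simp_all add: comm_def free_alg_closed free_alg_diff_closed)
qed

lemma lie_cls_cong: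
  assumes "x - y \<in> lie_ideal R"
  shows "lie_cls R x = lie_cls R y"
proof -
  have sub: "lie_cls R x \<subseteq> lie_cls R y" if "x - y \<in> lie_ideal R" for x y
  proof
    fix z assume "z \<in> lie_cls R x"
    then obtain u where "u \<in> lie_ideal R" "z = y + (x - y + u)"
      by (auto simp: lie_cls_def)
    then show "z \<in> lie_cls R y" unfolding lie_cls_def using lie_ideal.add[OF that] by blast
  qed
  have "y - x \<in> lie_ideal R"
    using lie_ideal.scale[OF assms, of "- 1"] by (simp add: pscale_minus_one)
  with assms sub show ?thesis by blast
qed

text \<open>The minus sign of the commutator is written as the scalar -1, because sums, products and
  scalars are what \<open>alg_hom\<close> preserves by definition.\<close>

lemma env_in_hom:
  shows "env_in R (x + y) = env_in R x \<oplus>\<^bsub>env_alg R\<^esub> env_in R y"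
    and "env_in R (c \<cdot> x) = c \<odot>\<^bsub>env_alg R\<^esub> env_in R x"
    and "env_in R (brk x y) = (env_in R x \<otimes>\<^bsub>env_alg R\<^esub> env_in R y) \<oplus>\<^bsub>env_alg R\<^esub>
      ((- 1) \<odot>\<^bsub>env_alg R\<^esub> (env_in R y \<otimes>\<^bsub>env_alg R\<^esub> env_in R x))"
    and "env_in R x \<in> carrier (env_alg R)"
proof -
  let ?S = "range (lie_cls R)"
  let ?g = "\<lambda>x. gen (lie_cls R x)"
  have gc: "?g x \<in> carrier (free_alg ?S)" for x by (simp add: free_alg_closed)
  note h = pres_cls_hom[OF env_rels_carrier[of R]]
  note eqI = pres_cls_eqI[OF env_rels_carrier[of R]]
  note defs = env_in_def env_alg_def
  have "pres_cls ?S (env_rels R) (?g (x + y)) = pres_cls ?S (env_rels R) (?g x + ?g y)"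
    using env_rels.intros(1)[of R x y]
    by (intro eqI) (auto simp: free_alg_closed gc diff_diff_eq)
  then show "env_in R (x + y) = env_in R x \<oplus>\<^bsub>env_alg R\<^esub> env_in R y"
    using alg_hom_memE(3)[OF h gc gc] by (simp add: defs)
  have "pres_cls ?S (env_rels R) (?g (c \<cdot> x)) = pres_cls ?S (env_rels R) (c \<cdot> ?g x)"
    using env_rels.intros(2)[of R c x] by (intro eqI) (auto simp: free_alg_closed gc)
  then show "env_in R (c \<cdot> x) = c \<odot>\<^bsub>env_alg R\<^esub> env_in R x"
    using alg_hom_memE(5)[OF h gc] by (simp add: defs)
  have c1: "?g x * ?g y \<in> carrier (free_alg ?S)" for x y
    by (simp add: free_alg_closed gc)
  have "pres_cls ?S (env_rels R) (?g (brk x y)) = pres_cls ?S (env_rels R) (?g x * ?g y + (- 1) \<cdot> (?g y * ?g x))"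
    using env_rels.intros(3)[of R x y]
    by (intro eqI) (auto simp: free_alg_closed free_alg_diff_closed gc comm_def pscale_minus_one)
  then show "env_in R (brk x y) = (env_in R x \<otimes>\<^bsub>env_alg R\<^esub> env_in R y) \<oplus>\<^bsub>env_alg R\<^esub>
      ((- 1) \<odot>\<^bsub>env_alg R\<^esub> (env_in R y \<otimes>\<^bsub>env_alg R\<^esub> env_in R x))"
    using alg_hom_memE(3)[OF h c1[of x y] free_alg_closed(5)[OF c1[of y x], of "- 1"]]
      alg_hom_memE(5)[OF h c1[of y x], of "- 1"] alg_hom_memE(2)[OF h gc gc]
    by (simp add: defs)
  show "env_in R x \<in> carrier (env_alg R)"
    using alg_hom_memE(1)[OF h gc] by (simp add: defs)
qed

lemma brk_single:
  "brk (Poly_Mapping.single s a) (Poly_Mapping.single t b) = Poly_Mapping.single (Br s t) (a * b)"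
  by (simp add: brk_def)

lemma alg_hom_brk:
  assumes "f \<in> alg_hom (env_alg R) B"
  shows "f (env_in R (brk x y)) = (f (env_in R x) \<otimes>\<^bsub>B\<^esub> f (env_in R y)) \<oplus>\<^bsub>B\<^esub>
    ((- 1) \<odot>\<^bsub>B\<^esub> (f (env_in R y) \<otimes>\<^bsub>B\<^esub> f (env_in R x)))"
proof -
  have m: "env_in R x \<otimes>\<^bsub>env_alg R\<^esub> env_in R y \<in> carrier (env_alg R)" for x y
    using ring.ring_simprules(5)[OF ring_pres_alg[OF env_rels_carrier]] env_in_hom(4)[of R]
    by (metis env_alg_def)
  have s: "c \<odot>\<^bsub>env_alg R\<^esub> z \<in> carrier (env_alg R)" if "z \<in> carrier (env_alg R)" for c z
    using that pres_alg_smult_closed[OF env_rels_carrier] by (simp add: env_alg_def)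
  note h = alg_hom_memE[OF assms]
  show ?thesis
    unfolding env_in_hom(3)
    by (simp add: h(2) h(3) h(5) m s env_in_hom(4))
qed

lemma alg_hom_diff:
  assumes "f \<in> alg_hom (env_alg R) B"
  shows "f (env_in R (x - y)) = f (env_in R x) \<oplus>\<^bsub>B\<^esub> ((- 1) \<odot>\<^bsub>B\<^esub> f (env_in R y))"
proof -
  have "env_in R (x - y) = env_in R x \<oplus>\<^bsub>env_alg R\<^esub> env_in R ((- 1) \<cdot> y)"
    using env_in_hom(1)[of R x "(- 1) \<cdot> y"] by (simp add: pscale_minus_one)
  then show ?thesis
    using alg_hom_memE(3)[OF assms env_in_hom(4) env_in_hom(4), of x "(- 1) \<cdot> y"]
      alg_hom_memE(5)[OF assms env_in_hom(4), of "- 1" y] by (simp add: env_in_hom(2))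
qed

text \<open>Bracketings of letters span the Lie algebra, and agreement passes through brackets since
  these become commutators. The enveloping algebra is then generated by the image of the Lie
  algebra.\<close>

lemma env_alg_hom_eqI:
  assumes f: "f \<in> alg_hom (env_alg R) B" and g: "g \<in> alg_hom (env_alg R) B"
    and gens: "\<And>a. f (env_in R (lgen a)) = g (env_in R (lgen a))"
    and u: "u \<in> carrier (env_alg R)"
  shows "f u = g u"
proof -
  let ?E = "\<lambda>x. f (env_in R x) = g (env_in R x)"
  have add: "?E (x + y)" if "?E x" "?E y" for x y
    using that alg_hom_memE(3)[OF f env_in_hom(4) env_in_hom(4), of x y]
      alg_hom_memE(3)[OF g env_in_hom(4) env_in_hom(4), of x y] by (simp add: env_in_hom(1))
  have scale: "?E (c \<cdot> x)" if "?E x" for c x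
    using that alg_hom_memE(5)[OF f env_in_hom(4), of c x]
      alg_hom_memE(5)[OF g env_in_hom(4), of c x] by (simp add: env_in_hom(2))
  have brk: "?E (brk x y)" if "?E x" "?E y" for x y
    using that by (simp add: alg_hom_brk[OF f] alg_hom_brk[OF g])
  have "?E (Poly_Mapping.single t 1)" for t
  proof (induction t)
    case (Leaf a)
    then show ?case using gens[of a] by (simp add: lgen_def)
  next
    case (Br s t)
    then show ?case using brk[of "Poly_Mapping.single s 1" "Poly_Mapping.single t 1"]
      by (simp add: brk_single)
  qed
  then have single: "?E (Poly_Mapping.single t c)" for t c
    using scale[of "Poly_Mapping.single t 1" c] by simp
  \<comment> \<open>Any tree serves here, its coefficient being 0.\<close>
  have zero: "?E 0" using single[of undefined 0] by simp
  have sum: "?E (\<Sum>t\<in>K. Poly_Mapping.single t (c t))" for K c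
    by (induction K rule: infinite_finite_induct) (simp_all add: zero add single)
  have "?E x" for x
    using sum[of "Poly_Mapping.lookup x" "Poly_Mapping.keys x"]
    by (simp only: poly_mapping_sum_single[symmetric])
  then have "f (pres_cls (range (lie_cls R)) (env_rels R) (gen s)) = g (pres_cls (range (lie_cls R)) (env_rels R) (gen s))"
    if "s \<in> range (lie_cls R)" for s
    using that by (auto simp: env_in_def)
  from pres_alg_hom_eqI[OF env_rels_carrier f[unfolded env_alg_def] g[unfolded env_alg_def] this u[unfolded env_alg_def]]
  show ?thesis .
qed

text \<open>The relation for [X^+, X^-] with equal indices expresses first the H and then C through
  brackets of the X.\<close>

lemma Ut_hom_eqI:
  assumes f: "f \<in> alg_hom (Ut A) B" and g: "g \<in> alg_hom (Ut A) B"
    and X: "\<And>s i r. f (ut A (GX s i r)) = g (ut A (GX s i r))"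
    and u: "u \<in> carrier (Ut A)"
  shows "f u = g u"
  using f g
  unfolding Ut_def
proof (rule env_alg_hom_eqI)
  let ?E = "\<lambda>x. f (env_in (t_rels A) x) = g (env_in (t_rels A) x)"
  note f' = f[unfolded Ut_def] and g' = g[unfolded Ut_def]
  have tX: "?E (tX s i p)" for s i p
    using X by (simp add: tX_def ut_def)
  have brk: "?E (brk x y)" if "?E x" "?E y" for x y
    using that by (simp add: alg_hom_brk[OF f'] alg_hom_brk[OF g'])
  have diff: "?E (x - y)" if "?E x" "?E y" for x y
    using that by (simp add: alg_hom_diff[OF f'] alg_hom_diff[OF g'])
  have cong: "?E x" if "?E y" "y - x \<in> t_rels A" for x y
    using that lie_cls_cong[OF lie_ideal.rel, of y x "t_rels A"] by (simp add: env_in_def)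
  have rel: "brk (tX Pl i p) (tX Mi i q) - (tH i (p + q + 1) - delta_z p q \<cdot> lgen GC) \<in> t_rels A" for i p q
  proof -
    have "(\<lambda>k. delta k q \<cdot> tH i (p - k)) = (\<lambda>k. if k = - 1 - q then tH i (p - k) else 0)"
      by (auto simp: delta_def)
    then have "Sum_any (\<lambda>k. delta k q \<cdot> tH i (p - k)) = tH i (p + q + 1)"
      by (simp only: Sum_any.delta) (simp add: algebra_simps)
    then show ?thesis using t_rels.intros(4)[of i p i q A] by simp
  qed
  have H: "?E (tH i q)" for i q
  proof (rule cong[OF brk[OF tX tX]])
    \<comment> \<open>At p = -1 the factor p + 1 vanishes, so the bracket equals H alone.\<close>
    have "delta_z (- 1) q = 0" by (simp add: delta_z_def)
    with rel[of i "- 1" q] show "brk (tX Pl i (- 1)) (tX Mi i q) - tH i q \<in> t_rels A"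
      by (simp del: of_int_add)
  qed
  have C: "?E (lgen GC)"
  proof -
    \<comment> \<open>An arbitrary index will do. At (p, q) = (0, -2) the coefficient of C is -1, so
      C is the difference of an H already treated and a bracket.\<close>
    fix i
    have "tH i (-1) - brk (tX Pl i 0) (tX Mi i (-2)) - lgen GC \<in> lie_ideal (t_rels A)"
      using lie_ideal.scale[OF lie_ideal.rel[OF rel[of i 0 "-2"]], of "- 1"]
      by (simp add: delta_z_def pscale_minus_one algebra_simps)
    from lie_cls_cong[OF this] show ?thesis
      using diff[OF H brk[OF tX tX]] by (metis env_in_def)
  qed
  show "?E (lgen a)" for a
  proof (cases a)
    case (GX s i r)
    then show ?thesis using tX[of s i "- r - 1"] by (simp add: tX_def)
  next
    case (GH i r)
    then show ?thesis using H[of i "- r - 1"] by (simp add: tH_def)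
  qed (use C in simp)
  show "u \<in> carrier (env_alg (t_rels A))" using u by (simp add: Ut_def)
qed

section \<open>The filtered morphisms and the leading-term representation\<close>

theorem corollary5p11:
  fixes A :: "'i::finite \<Rightarrow> 'i \<Rightarrow> int"
    and \<epsilon> :: "'i rootlat \<Rightarrow> 'i rootlat \<Rightarrow> complex"
    and \<rho> :: "'i dgen falg set \<Rightarrow> int \<Rightarrow> 'i vop"
    and \<iota> :: "'i ygen falg set \<Rightarrow> 'i dgen falg set"
    and \<phi> :: "'i dgen nalg set falg set \<Rightarrow> int \<Rightarrow> 'i dgen falg set set"
  assumes "simply_laced A"
    and "cocycle A \<epsilon>"
    and rho_hom: "\<rho> \<in> alg_hom (DY A) (tEnd A)"
    and rho_x: "\<And>s i r. \<rho> (dy A (gen (GX s i r))) = rho_x A \<epsilon> s i r"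
    and rho_c: "\<rho> (dy A (gen GC)) = \<one>\<^bsub>tEnd A\<^esub>"
    and iota_hom: "\<iota> \<in> alg_hom (Y A) (DY A)"
    and iota_x: "\<And>s i r. \<iota> (ycls A (gen (YX s i r))) = dy A (iota_x s i r)"
    and iota_h: "\<And>i r. \<iota> (ycls A (gen (YH i r))) = dy A (gen (GH i (int r)))"
    and phi_hom: "\<phi> \<in> alg_hom (Ut A) (gr_alg (DY A) (FD A))"
    and phi_x: "\<And>s i r. \<phi> (ut A (GX s i r)) = gr_cls (DY A) (FD A) r (dy A (gen (GX s i r)))"
    and phi_h: "\<And>i r. \<phi> (ut A (GH i r)) = gr_cls (DY A) (FD A) r (dy A (gen (GH i r)))"
    and phi_c: "\<phi> (ut A GC) = gr_cls (DY A) (FD A) 0 (dy A (gen GC))"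
  shows "filtered_hom (DY A) (FD A) (tEnd A) (FV A) \<rho>
    \<and> filtered_hom (Y A) (FY A) (tEnd A) (FV A) (\<rho> \<circ> \<iota>)
    \<and> gr_rho A \<rho> \<in> alg_hom (gr_alg (DY A) (FD A)) EndV
    \<and> gr_rho A \<rho> \<circ> \<phi> \<in> alg_hom (Ut A) EndV
    \<and> (\<forall>s i r. (gr_rho A \<rho> \<circ> \<phi>) (ut A (GX s i r)) = Xring A \<epsilon> s i r)
    \<and> (\<forall>\<rho>0 \<in> alg_hom (Ut A) EndV. (\<forall>s i r. \<rho>0 (ut A (GX s i r)) = Xring A \<epsilon> s i r) \<longrightarrow>
         (\<forall>u\<in>carrier (Ut A). \<rho>0 u = (gr_rho A \<rho> \<circ> \<phi>) u))"
proof -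
  note A = \<open>simply_laced A\<close>
  have dy_hom: "dy A \<in> alg_hom (free_alg UNIV) (DY A)"
    unfolding dy_def DY_def by (rule pres_cls_hom) simp
  \<comment> \<open>The filtration of the operators, pulled back to the free algebra on the
    generators of the Yangian double.\<close>
  define W where "W = (\<lambda>k. {x. (\<rho> \<circ> dy A) x \<in> FV A k})"
  have W: "falg_filtration W"
    unfolding W_def by (rule tEnd_filtration) (rule alg_hom_comp[OF dy_hom rho_hom])
  have rels: "dy_rels A \<subseteq> W k" for k
    using pres_cls_rel[OF rho_hom[unfolded DY_def]] by (auto simp: W_def dy_def)
  have gc: "gen GC \<in> W 0" using FV_one[of A] by (simp add: W_def rho_c)
  \<comment> \<open>Homogeneity of the components comes from the values of \<rho> lying in
    \<open>tEnd A\<close>; the formula for the vertex operator supplies the vanishing above degree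
    r.\<close>
  have gx: "gen (GX s i r) \<in> W r" for s i r
  proof -
    have "\<rho> (dy A (gen (GX s i r))) \<in> carrier (tEnd A)"
      using alg_hom_memE(1)[OF alg_hom_comp[OF dy_hom rho_hom], of "gen (GX s i r)"] by simp
    then show ?thesis
      using rho_x_degree(1)[OF A, of r _ \<epsilon> s i] by (auto simp: W_def FV_def rho_x)
  qed
  \<comment> \<open>The values of \<rho> on the h are not prescribed, so their degrees are obtained
    from the relations.\<close>
  have gh: "gen (GH i r) \<in> W r" for i r
    by (rule gen_GH_in_filtration[OF W rels gx gc])
  have gens: "\<rho> (dy A (gen g)) \<in> FV A (dy_deg g)" for g
    using gc gx gh by (cases g) (simp_all add: W_def dy_deg_def)
  have filt_D: "filtered_hom (DY A) (FD A) (tEnd A) (FV A) \<rho>"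
    unfolding DY_def FD_def
    by (rule filtered_hom_pres_algI[OF rho_hom[unfolded DY_def] gens[unfolded dy_def]])
  have "(\<rho> \<circ> \<iota>) (ycls A (gen g)) \<in> FV A (y_deg g)" for g
    using iota_x_in_filtration[OF W gx gc] gh
    by (cases g) (auto simp: y_deg_def iota_x iota_h W_def)
  then have filt_Y: "filtered_hom (Y A) (FY A) (tEnd A) (FV A) (\<rho> \<circ> \<iota>)"
    unfolding Y_def FY_def
    by (intro filtered_hom_pres_algI alg_hom_comp[OF iota_hom[unfolded Y_def] rho_hom])
      (simp add: ycls_def)
  have FDI: "dy A x \<in> FD A k" if "\<forall>w\<in>Poly_Mapping.keys x. (\<Sum>g\<leftarrow>letters w. dy_deg g) \<le> k" for x k
    using that by (auto simp: FD_def pres_filt_def dy_def)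
  interpret filtered_rep A "DY A" "FD A" \<rho>
  proof (rule filtered_rep.intro)
    show "ring (DY A)" unfolding DY_def by (rule ring_pres_alg) simp
    then have zero: "\<zero>\<^bsub>DY A\<^esub> = dy A 0"
      using ring_hom_zero[of "dy A" "free_alg UNIV" "DY A"] dy_hom ring_free_alg
      by (auto simp: alg_hom_def)
    \<comment> \<open>The zero element has no monomials and hence satisfies every degree
      bound.\<close>
    show "\<zero>\<^bsub>DY A\<^esub> \<in> FD A k" for k unfolding zero by (rule FDI) simp
    show "FD A k \<subseteq> carrier (DY A)" for k
      by (auto simp: FD_def pres_filt_def DY_def pres_alg_simps)
    show "c \<odot>\<^bsub>DY A\<^esub> x \<in> carrier (DY A)" if "x \<in> carrier (DY A)" for x c
      using that pres_alg_smult_closed[of "dy_rels A" UNIV] by (simp add: DY_def)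
  qed (rule filt_D)
  have comp_hom: "gr_rho A \<rho> \<circ> \<phi> \<in> alg_hom (Ut A) EndV"
    by (rule alg_hom_comp[OF phi_hom gr_rho_hom])
  have comp_X: "(gr_rho A \<rho> \<circ> \<phi>) (ut A (GX s i r)) = Xring A \<epsilon> s i r" for s i r
  proof -
    have "dy A (gen (GX s i r)) \<in> FD A r"
      by (rule FDI) (simp add: gen_def dy_deg_def)
    then show ?thesis
      by (simp add: phi_x gr_rho_cls rho_x rho_x_degree(2)[OF A])
  qed
  \<comment> \<open>The composite is itself a representation with the prescribed values on the X, so
    existence is settled; agreement on the X settles uniqueness.\<close>
  have "\<forall>u\<in>carrier (Ut A). \<rho>0 u = (gr_rho A \<rho> \<circ> \<phi>) u"
    if "\<rho>0 \<in> alg_hom (Ut A) EndV" "\<forall>s i r. \<rho>0 (ut A (GX s i r)) = Xring A \<epsilon> s i r" for \<rho>0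
    using Ut_hom_eqI[OF that(1) comp_hom] that(2) comp_X by simp
  with filt_D filt_Y gr_rho_hom comp_hom comp_X show ?thesis by blast
qed

end
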